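(* Let $n\ge1$, $0\le\ell\le2n$, $\lambda=\max\{\ell,2n-\ell\}$, and let $\varphi^{AE}$ be any density operator on $\mathcal H_A\otimes\mathcal H_E$ with $\mathcal H_A=(\mathbb C^2)^{\otimes n}$ and $\mathcal H_E$ finite-dimensional. Then $$\mathbb E_{u,v}\big\|R_{uv}(\varphi^{AE})-\tau^A\otimes\varphi^E\big\|_1\;\le\;\sqrt{2^{\,n-\ell-\mathsf H_2(A|E)_\varphi}},$$ where $u$ is uniform on $\{0,1\}^\lambda$, $v$ uniform on $\{0,1\}^{2n-\ell}$, $\tau^A=\mathbb 1_A/2^n$, $\varphi^E=\mathrm{Tr}_A\varphi^{AE}$, and $\|M\|_1=\mathrm{Tr}\sqrt{M^\dagger M}$.
   Context: Let $X=\begin{pmatrix}0&1\\1&0\end{pmatrix}$, $Z=\begin{pmatrix}1&0\\0&-1\end{pmatrix}$. For $\beta=s\|q\in\{0,1\}^{2n}$ ($s,q\in\{0,1\}^n$) let $U_\beta=\bigotimes_{i=1}^nX^{s_i}Z^{q_i}$ and $F_\beta(\rho)=(U_\beta\otimes\mathbb 1_E)\rho(U_\beta^\dagger\otimes\mathbb 1_E)$. Bit strings are identified with elements of $\mathrm{GF}(2^\lambda)$ via the polynomial representation; $(w)_{\rm lsb}$ denotes the last $2n-\ell$ bits of $w$ (the polynomial modulo $x^{2n-\ell}$). For $k\in\{0,1\}^\ell$, $u\in\{0,1\}^\lambda$, $v\in\{0,1\}^{2n-\ell}$, $b(k,u,v)=k\,\|\,((uk)_{\rm lsb}+v)$ (concatenation;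 product in $\mathrm{GF}(2^\lambda)$; $+$ is XOR), and $R_{uv}(\varphi^{AE})=2^{-\ell}\sum_{k\in\{0,1\}^\ell}F_{b(k,u,v)}(\varphi^{AE})$. Conditional collision entropy (sandwiched Rényi, order 2): for $\rho,\sigma\ge0$, $\rho\ne0$, $D_2(\rho\|\sigma)=\log_2\mathrm{Tr}\big[(\sigma^{-1/4}\rho\,\sigma^{-1/4})^2\big]$ if the kernel of $\sigma$ is contained in the kernel of $\rho$, and $+\infty$ otherwise; and $\mathsf H_2(A|E)_\varphi=-\inf_{\sigma_E}D_2(\varphi^{AE}\|\mathbb 1_A\otimes\sigma_E)$, the infimum over density operators $\sigma_E$ on $\mathcal H_E$. *)

theory Defs
  imports Complex_Main "Jordan_Normal_Form.Matrix" "HOL-Computational_Algebra.Polynomial"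
    "HOL-Library.Z2" "HOL-Library.Extended_Real"
begin

definition adj :: "complex mat \<Rightarrow> complex mat" where
  "adj M = mat (dim_col M) (dim_row M) (\<lambda>(i,j). cnj (M $$ (j,i)))"

definition tr :: "complex mat \<Rightarrow> complex" where
  "tr M = (\<Sum>i<dim_row M. M $$ (i,i))"

definition kron :: "complex mat \<Rightarrow> complex mat \<Rightarrow> complex mat" where
  "kron A B = mat (dim_row A * dim_row B) (dim_col A * dim_col B)
     (\<lambda>(i,j). A $$ (i div dim_row B, j div dim_col B) * B $$ (i mod dim_row B, j mod dim_col B))"

definition hermitian :: "complex mat \<Rightarrow> bool" where
  "hermitian M \<longleftrightarrow> dim_row M = dim_col M \<and> adj M = M"

definition psd :: "complex mat \<Rightarrow> bool" where
  "psd M \<longleftrightarrow> hermitian M \<and>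
     (\<forall>v. dim_vec v = dim_row M \<longrightarrow> 0 \<le> Re (conjugate v \<bullet> (M *\<^sub>v v)))"

definition density :: "nat \<Rightarrow> complex mat \<Rightarrow> bool" where
  "density d M \<longleftrightarrow> M \<in> carrier_mat d d \<and> psd M \<and> tr M = 1"

definition unitary :: "complex mat \<Rightarrow> bool" where
  "unitary U \<longleftrightarrow> dim_row U = dim_col U \<and> adj U * U = 1\<^sub>m (dim_row U)"

definition diag_mat :: "nat \<Rightarrow> (nat \<Rightarrow> complex) \<Rightarrow> complex mat" where
  "diag_mat d f = mat d d (\<lambda>(i,j). if i = j then f i else 0)"

definition matfun :: "(real \<Rightarrow> real) \<Rightarrow> complex mat \<Rightarrow> complex mat" where
  "matfun f A = (SOME B. \<exists>U d. U \<in> carrier_mat (dim_row A) (dim_row A) \<and> unitary U \<and>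
       (\<forall>i<dim_row A. d i \<in> \<real>) \<and> A = U * diag_mat (dim_row A) d * adj U \<and>
       B = U * diag_mat (dim_row A) (\<lambda>i. complex_of_real (f (Re (d i)))) * adj U)"

definition msqrt :: "complex mat \<Rightarrow> complex mat" where
  "msqrt A = matfun sqrt A"

definition mpow_m14 :: "complex mat \<Rightarrow> complex mat" where
  "mpow_m14 A = matfun (\<lambda>x. if x > 0 then x powr (-1/4) else 0) A"

definition trace_norm :: "complex mat \<Rightarrow> real" where
  "trace_norm M = Re (tr (msqrt (adj M * M)))"

definition D2 :: "complex mat \<Rightarrow> complex mat \<Rightarrow> ereal" where
  "D2 \<rho> \<sigma> = (if (\<forall>v. dim_vec v = dim_col \<sigma> \<longrightarrow> \<sigma> *\<^sub>v v = 0\<^sub>v (dim_row \<sigma>)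
                        \<longrightarrow> \<rho> *\<^sub>v v = 0\<^sub>v (dim_row \<rho>))
     then ereal (log 2 (Re (tr ((mpow_m14 \<sigma> * \<rho> * mpow_m14 \<sigma>) * (mpow_m14 \<sigma> * \<rho> * mpow_m14 \<sigma>)))))
     else \<infinity>)"

text \<open>Bipartite system A (dimension dA) and E (dimension dE); index of basis vector
  (a,e) is a*dE+e.\<close>
definition H2 :: "nat \<Rightarrow> nat \<Rightarrow> complex mat \<Rightarrow> ereal" where
  "H2 dA dE \<phi> = - Inf {D2 \<phi> (kron (1\<^sub>m dA) \<sigma>) | \<sigma>. density dE \<sigma>}"

definition ptrace_A :: "nat \<Rightarrow> nat \<Rightarrow> complex mat \<Rightarrow> complex mat" where
  "ptrace_A dA dE \<phi> = mat dE dE (\<lambda>(e,e'). \<Sum>a<dA. \<phi> $$ (a*dE+e, a*dE+e'))"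

definition maxmixed :: "nat \<Rightarrow> complex mat" where
  "maxmixed d = mat d d (\<lambda>(i,j). if i = j then 1 / of_nat d else 0)"

definition pauliX :: "complex mat" where
  "pauliX = mat 2 2 (\<lambda>(i,j). if i \<noteq> j then 1 else 0)"

definition pauliZ :: "complex mat" where
  "pauliZ = mat 2 2 (\<lambda>(i,j). if i = j then (if i = 0 then 1 else -1) else 0)"

fun tensor_list :: "complex mat list \<Rightarrow> complex mat" where
  "tensor_list [] = 1\<^sub>m 1"
| "tensor_list (M # Ms) = kron M (tensor_list Ms)"

text \<open>Bit strings of length m are encoded as naturals below 2^m, the first bit being the
  most significant one. So for beta = s||q (2n bits), s = beta div 2^n, q = beta mod 2^n,
  and s_i = bit s (n - i) for i = 1..n.\<close>
definition pauli_op :: "nat \<Rightarrow> nat \<Rightarrow> complex mat" where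
  "pauli_op n \<beta> = tensor_list (map (\<lambda>i.
      (if bit (\<beta> div 2^n) (n - i) then pauliX else 1\<^sub>m 2) *
      (if bit (\<beta> mod 2^n) (n - i) then pauliZ else 1\<^sub>m 2)) [1..<n+1])"

definition F_op :: "nat \<Rightarrow> nat \<Rightarrow> nat \<Rightarrow> complex mat \<Rightarrow> complex mat" where
  "F_op n dE \<beta> \<rho> = kron (pauli_op n \<beta>) (1\<^sub>m dE) * \<rho> * adj (kron (pauli_op n \<beta>) (1\<^sub>m dE))"

text \<open>Bit string w_1..w_m (encoded as nat w) corresponds to the polynomial
  sum_j w_j x^(m-j), i.e. coefficient of x^i is bit i of w.\<close>
definition poly_of_bits :: "nat \<Rightarrow> bit poly" where
  "poly_of_bits w = Poly (map (\<lambda>i. of_bool (bit w i)) [0..<w+1])"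

definition bits_of_poly :: "bit poly \<Rightarrow> nat" where
  "bits_of_poly p = (\<Sum>i\<le>degree p. if coeff p i = 1 then 2^i else 0)"

definition gf_mult :: "bit poly \<Rightarrow> nat \<Rightarrow> nat \<Rightarrow> nat" where
  "gf_mult P a b = bits_of_poly ((poly_of_bits a * poly_of_bits b) mod P)"

definition b_fun :: "bit poly \<Rightarrow> nat \<Rightarrow> nat \<Rightarrow> nat \<Rightarrow> nat \<Rightarrow> nat \<Rightarrow> nat" where
  "b_fun P n l k u v = k * 2^(2*n-l) + (xor (gf_mult P u k mod 2^(2*n-l)) v)"

definition R_op :: "bit poly \<Rightarrow> nat \<Rightarrow> nat \<Rightarrow> nat \<Rightarrow> nat \<Rightarrow> nat \<Rightarrow> complex mat \<Rightarrow> complex mat" where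
  "R_op P n l dE u v \<phi> = mat (dim_row \<phi>) (dim_col \<phi>) (\<lambda>ij. (1 / 2^l) *
     (\<Sum>k<2^l. F_op n dE (b_fun P n l k u v) \<phi> $$ ij))"

end

theory Submission
  imports Defs "Jordan_Normal_Form.Spectral_Radius" "HOL-Analysis.Convex"
    "HOL-Computational_Algebra.Polynomial_Factorial"
begin

text \<open>
  For a density operator \<open>\<sigma>\<close> on \<open>E\<close> put \<open>G = \<one> \<otimes> \<sigma>\<close> and \<open>X = G\<^bsup>-1/4\<^esup> \<phi> G\<^bsup>-1/4\<^esup>\<close>. Two applications of the
  Cauchy--Schwarz inequality bound the squared trace norm of \<open>M = G\<^bsup>1/4\<^esup> N G\<^bsup>1/4\<^esup>\<close> by
  \<open>Tr G \<cdot> Tr N\<^sup>2 = 2\<^sup>n Tr N\<^sup>2\<close>. Since \<open>G\<close> commutes with \<open>U\<^sub>\<beta> \<otimes> \<one>\<close>, this applies to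
  \<open>M = R\<^sub>u\<^sub>v(\<phi>) - \<tau> \<otimes> \<phi>\<^sup>E\<close> with \<open>N = R\<^sub>u\<^sub>v(X) - \<tau> \<otimes> X\<^sup>E\<close>, where \<open>\<tau> \<otimes> X\<^sup>E\<close> is the average of all \<open>F\<^sub>\<beta>(X)\<close>.
  Writing \<open>t(\<beta>) = Tr X F\<^sub>\<beta>(X) \<ge> 0\<close>, the group law \<open>F\<^sub>\<beta> F\<^sub>\<gamma> = F\<^sub>\<beta>\<^sub>+\<^sub>\<gamma>\<close> expresses \<open>Tr N\<^sup>2\<close> through
  \<open>t(b(j,u,v) + b(k,u,v))\<close>. For \<open>j \<noteq> k\<close> the last \<open>2n - l\<close> bits of this argument are uniform in \<open>u\<close>, so the
  mean of \<open>Tr N\<^sup>2\<close> is at most \<open>2\<^bsup>-l\<^esup> t(0) = 2\<^bsup>-l\<^esup> Tr X\<^sup>2\<close>. Jensen's inequality and the infimum over \<open>\<sigma>\<close>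
  give the bound.
\<close>

section \<open>Spectral calculus for Hermitian matrices\<close>

hide_const (open) Matrix.diag_mat

section \<open>Adjoint, trace and diagonal matrices\<close>

lemma mult_mat_assoc:
  fixes A B C :: "'a :: semiring_0 mat"
  assumes "dim_col A = dim_row B" "dim_col B = dim_row C"
  shows "A * B * C = A * (B * C)"
  using assms by (intro assoc_mult_mat[of _ "dim_row A" "dim_row B" _ "dim_row C" _ "dim_col C"]) auto

lemma index_mult_mat_sum:
  fixes A B :: "'a :: semiring_0 mat"
  assumes "i < dim_row A" "j < dim_col B" "dim_col A = dim_row B"
  shows "(A * B) $$ (i,j) = (\<Sum>k<dim_row B. A $$ (i,k) * B $$ (k,j))"
  using assms by (auto simp: scalar_prod_def lessThan_atLeast0 intro!: sum.cong)

lemma dim_adj[simp]: "dim_row (adj A) = dim_col A" "dim_col (adj A) = dim_row A"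
  by (auto simp: adj_def)

lemma adj_carrier[simp]: "A \<in> carrier_mat r c \<Longrightarrow> adj A \<in> carrier_mat c r"
  by (auto simp: adj_def)

lemma index_adj[simp]: "i < dim_col A \<Longrightarrow> j < dim_row A \<Longrightarrow> adj A $$ (i,j) = cnj (A $$ (j,i))"
  by (auto simp: adj_def)

lemma adj_adj[simp]: "adj (adj A) = A"
  by (rule eq_matI) auto

lemma adj_one[simp]: "adj (1\<^sub>m k) = 1\<^sub>m k"
  by (rule eq_matI) auto

lemma adj_mult:
  assumes "dim_col A = dim_row B"
  shows "adj (A * B) = adj B * adj A"
proof (rule eq_matI)
  fix i j assume "i < dim_row (adj B * adj A)" "j < dim_col (adj B * adj A)"
  then have ij: "i < dim_col B" "j < dim_row A" by auto
  then have "adj (A * B) $$ (i,j) = cnj (\<Sum>k<dim_row B. A $$ (j,k) * B $$ (k,i))"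
    using assms by (simp add: index_mult_mat_sum del: index_mult_mat(1))
  also have "\<dots> = (adj B * adj A) $$ (i,j)"
    using ij assms by (subst index_mult_mat_sum) (auto intro!: sum.cong)
  finally show "adj (A * B) $$ (i,j) = (adj B * adj A) $$ (i,j)" .
qed (auto simp: assms)

lemma tr_mult:
  assumes "dim_col A = dim_row B" "dim_row A = dim_col B"
  shows "tr (A * B) = (\<Sum>i<dim_row A. \<Sum>k<dim_row B. A $$ (i,k) * B $$ (k,i))"
  using assms by (auto simp: tr_def index_mult_mat_sum simp del: index_mult_mat(1) intro!: sum.cong)

lemma tr_mult_commute:
  assumes "dim_col A = dim_row B" "dim_row A = dim_col B"
  shows "tr (A * B) = tr (B * A)"
  using assms by (simp add: tr_mult mult.commute) (rule sum.swap)

lemma tr_adj_mult_self: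
  "tr (adj A * A) = of_real (\<Sum>(i,k)\<in>{..<dim_col A} \<times> {..<dim_row A}. (cmod (A $$ (k,i)))\<^sup>2)"
  by (auto simp: tr_mult sum.cartesian_product complex_norm_square mult.commute simp del: of_real_power
      intro!: sum.cong)

lemma Re_tr_adj_mult_self_nonneg: "0 \<le> Re (tr (adj A * A))"
  unfolding tr_adj_mult_self by (auto intro!: sum_nonneg)

text \<open>Cauchy-Schwarz for the Hilbert-Schmidt inner product: after the triangle inequality it
  is the real inequality for the moduli of the entries.\<close>

lemma tr_Cauchy_Schwarz:
  assumes "dim_row A = dim_row B" "dim_col A = dim_col B"
  shows "(cmod (tr (adj A * B)))\<^sup>2 \<le> Re (tr (adj A * A)) * Re (tr (adj B * B))"
proof -
  let ?I = "{..<dim_col A} \<times> {..<dim_row A}"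
  have "tr (adj A * B) = (\<Sum>(i,k)\<in>?I. cnj (A $$ (k,i)) * B $$ (k,i))"
    using assms by (auto simp: tr_mult sum.cartesian_product intro!: sum.cong)
  also have "cmod \<dots> \<le> (\<Sum>p\<in>?I. cmod (A $$ (snd p, fst p)) * cmod (B $$ (snd p, fst p)))"
    by (rule order.trans[OF norm_sum]) (auto simp: norm_mult intro!: sum_mono)
  finally have "(cmod (tr (adj A * B)))\<^sup>2 \<le> (\<Sum>p\<in>?I. cmod (A $$ (snd p, fst p)) * cmod (B $$ (snd p, fst p)))\<^sup>2"
    by (intro power_mono) auto
  also have "\<dots> \<le> (\<Sum>p\<in>?I. (cmod (A $$ (snd p, fst p)))\<^sup>2) * (\<Sum>p\<in>?I. (cmod (B $$ (snd p, fst p)))\<^sup>2)"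
    by (rule Cauchy_Schwarz_ineq_sum)
  also have "\<dots> = Re (tr (adj A * A)) * Re (tr (adj B * B))"
    unfolding tr_adj_mult_self using assms by (simp add: case_prod_beta)
  finally show ?thesis .
qed

lemma dim_diag_mat[simp]: "dim_row (diag_mat k f) = k" "dim_col (diag_mat k f) = k"
  by (auto simp: diag_mat_def)

lemma diag_mat_carrier[simp]: "diag_mat k f \<in> carrier_mat k k"
  by (auto simp: diag_mat_def)

lemma adj_diag_mat: "adj (diag_mat k f) = diag_mat k (\<lambda>i. cnj (f i))"
  by (rule eq_matI) (auto simp: diag_mat_def)

lemma diag_mat_cong: "(\<And>i. i < k \<Longrightarrow> f i = g i) \<Longrightarrow> diag_mat k f = diag_mat k g"
  by (rule eq_matI) (auto simp: diag_mat_def)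

lemma index_mult_diag_mat:
  assumes "dim_col A = k" "i < dim_row A" "j < k"
  shows "(A * diag_mat k f) $$ (i,j) = A $$ (i,j) * f j"
proof -
  have "(A * diag_mat k f) $$ (i,j) = (\<Sum>m<k. if m = j then A $$ (i,j) * f j else 0)"
    using assms by (subst index_mult_mat_sum) (auto simp: diag_mat_def intro!: sum.cong simp del: sum.delta sum.delta')
  then show ?thesis using assms by simp
qed

lemma index_diag_mat_mult:
  assumes "dim_row A = k" "i < k" "j < dim_col A"
  shows "(diag_mat k f * A) $$ (i,j) = f i * A $$ (i,j)"
proof -
  have "(diag_mat k f * A) $$ (i,j) = (\<Sum>m<k. if m = i then f i * A $$ (i,j) else 0)"
    using assms by (subst index_mult_mat_sum) (auto simp: diag_mat_def intro!: sum.cong simp del: sum.delta sum.delta')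
  then show ?thesis using assms by simp
qed

lemma diag_mat_mult: "diag_mat k f * diag_mat k g = diag_mat k (\<lambda>i. f i * g i)"
  by (rule eq_matI) (auto simp: index_mult_diag_mat simp del: index_mult_mat(1), auto simp: diag_mat_def)

lemma diag_mat_one: "diag_mat k (\<lambda>i. 1) = 1\<^sub>m k"
  by (rule eq_matI) (auto simp: diag_mat_def)

lemma tr_diag_mat: "tr (diag_mat k f) = (\<Sum>i<k. f i)"
  by (simp add: tr_def diag_mat_def)

lemma unitaryD:
  assumes "unitary U" "U \<in> carrier_mat k k"
  shows "adj U * U = 1\<^sub>m k" "U * adj U = 1\<^sub>m k"
proof -
  show *: "adj U * U = 1\<^sub>m k" using assms by (auto simp: unitary_def)
  show "U * adj U = 1\<^sub>m k"
    using mat_mult_left_right_inverse[OF _ assms(2) *] assms by auto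
qed

lemma unitary_cancel:
  assumes "unitary U" "U \<in> carrier_mat k k" "dim_row X = k"
  shows "adj U * (U * X) = X" "U * (adj U * X) = X"
proof -
  have X: "X \<in> carrier_mat k (dim_col X)" using assms by auto
  show "adj U * (U * X) = X"
    using unitaryD(1)[OF assms(1,2)] X assms by (simp flip: mult_mat_assoc)
  show "U * (adj U * X) = X"
    using unitaryD(2)[OF assms(1,2)] X assms by (simp flip: mult_mat_assoc)
qed

text \<open>\<open>d\<close> is real-valued, so the matrix is Hermitian by construction, and for
  unitary \<open>U\<close> the functional calculus is composition with \<open>d\<close>.\<close>

definition herm_diag :: "complex mat \<Rightarrow> nat \<Rightarrow> (nat \<Rightarrow> real) \<Rightarrow> complex mat" where
  "herm_diag U k d = U * diag_mat k (\<lambda>i. complex_of_real (d i)) * adj U"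

lemma dim_herm_diag[simp]:
  "U \<in> carrier_mat k k \<Longrightarrow> dim_row (herm_diag U k d) = k"
  "U \<in> carrier_mat k k \<Longrightarrow> dim_col (herm_diag U k d) = k"
  by (auto simp: herm_diag_def)

lemma herm_diag_carrier[simp]: "U \<in> carrier_mat k k \<Longrightarrow> herm_diag U k d \<in> carrier_mat k k"
  by (rule carrier_matI) auto

lemma herm_diag_cong: "(\<And>i. i < k \<Longrightarrow> d i = e i) \<Longrightarrow> herm_diag U k d = herm_diag U k e"
  unfolding herm_diag_def by (subst diag_mat_cong[of k _ "\<lambda>i. complex_of_real (e i)"]) auto

lemma adj_herm_diag[simp]:
  assumes "U \<in> carrier_mat k k"
  shows "adj (herm_diag U k d) = herm_diag U k d"
  using assms by (simp add: herm_diag_def adj_mult adj_diag_mat mult_mat_assoc)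

lemma herm_diag_mult:
  assumes "unitary U" "U \<in> carrier_mat k k"
  shows "herm_diag U k d * herm_diag U k e = herm_diag U k (\<lambda>i. d i * e i)"
proof -
  have "herm_diag U k d * herm_diag U k e =
    U * (diag_mat k (\<lambda>i. complex_of_real (d i)) * diag_mat k (\<lambda>i. complex_of_real (e i)) * adj U)"
    using assms by (simp add: herm_diag_def mult_mat_assoc unitary_cancel)
  then show ?thesis
    using assms by (simp add: herm_diag_def diag_mat_mult mult_mat_assoc)
qed

lemma herm_diag_one:
  assumes "unitary U" "U \<in> carrier_mat k k"
  shows "herm_diag U k (\<lambda>i. 1) = 1\<^sub>m k"
  using assms by (simp add: herm_diag_def diag_mat_one unitaryD)

text \<open>Comparing matrix entries in the two eigenbases: an entry of the intertwiner can only be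
  nonzero between equal eigenvalues.\<close>

lemma herm_diag_intertwine:
  assumes U: "unitary U" "U \<in> carrier_mat k k" and V: "unitary V" "V \<in> carrier_mat m m"
    and C: "C \<in> carrier_mat m k"
    and eq: "C * herm_diag U k d = herm_diag V m e * C"
  shows "C * herm_diag U k (\<lambda>i. f (d i)) = herm_diag V m (\<lambda>i. f (e i)) * C"
proof -
  let ?D = "\<lambda>g. diag_mat k (\<lambda>i. complex_of_real (g (d i)))"
  let ?E = "\<lambda>g. diag_mat m (\<lambda>i. complex_of_real (g (e i)))"
  define K where "K = adj V * (C * U)"
  have K: "K \<in> carrier_mat m k" using U V C by (auto simp: K_def)
  note [simp] = unitary_cancel[OF U] unitary_cancel[OF V] carrier_matD[OF U(2)]
    carrier_matD[OF V(2)] carrier_matD[OF C] carrier_matD[OF K]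
  have UD: "herm_diag U k d * U = U * ?D (\<lambda>x. x)"
    using U by (simp add: herm_diag_def mult_mat_assoc unitaryD)
  have VE: "adj V * (herm_diag V m e * (C * U)) = ?E (\<lambda>x. x) * K"
    using V by (simp add: herm_diag_def mult_mat_assoc K_def)
  have "K * ?D (\<lambda>x. x) = adj V * (C * (herm_diag U k d * U))"
    using U by (simp add: K_def UD mult_mat_assoc)
  also have "\<dots> = adj V * ((C * herm_diag U k d) * U)"
    using U by (simp add: mult_mat_assoc)
  also have "\<dots> = ?E (\<lambda>x. x) * K"
    unfolding eq VE[symmetric] using U V by (simp add: mult_mat_assoc)
  finally have K_eq: "K * ?D (\<lambda>x. x) = ?E (\<lambda>x. x) * K" .
  have KD: "K * ?D f = ?E f * K"
  proof (rule eq_matI)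
    fix i j assume "i < dim_row (?E f * K)" "j < dim_col (?E f * K)"
    then have ij: "i < m" "j < k" by auto
    have "(K * ?D (\<lambda>x. x)) $$ (i,j) = (?E (\<lambda>x. x) * K) $$ (i,j)" by (simp only: K_eq)
    then have "K $$ (i,j) * complex_of_real (d j) = complex_of_real (e i) * K $$ (i,j)"
      using ij by (simp add: index_mult_diag_mat index_diag_mat_mult del: index_mult_mat(1))
    then have "K $$ (i,j) = 0 \<or> d j = e i" by (auto simp: mult.commute)
    then show "(K * ?D f) $$ (i,j) = (?E f * K) $$ (i,j)"
      using ij by (auto simp: index_mult_diag_mat index_diag_mat_mult simp del: index_mult_mat(1))
  qed (simp_all)
  have "C * herm_diag U k (\<lambda>i. f (d i)) = V * ((K * ?D f) * adj U)"
    using U V by (simp add: herm_diag_def K_def mult_mat_assoc)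
  also have "\<dots> = V * (?E f * (K * adj U))"
    unfolding KD using U V by (simp add: mult_mat_assoc)
  also have "K * adj U = adj V * C"
    using U V C by (simp add: K_def mult_mat_assoc unitaryD)
  finally show ?thesis
    using U V by (simp add: herm_diag_def mult_mat_assoc)
qed

text \<open>\<open>matfun\<close> selects an arbitrary diagonalisation, so its value is known only
  once all diagonalisations agree. They do, because the identity intertwines any two
  diagonalisations of the same matrix.\<close>

lemma matfun_herm_diag:
  assumes U: "unitary U" "U \<in> carrier_mat k k"
  shows "matfun f (herm_diag U k d) = herm_diag U k (\<lambda>i. f (d i))"
proof -
  let ?A = "herm_diag U k d"
  define P where "P = (\<lambda>B. \<exists>W c. W \<in> carrier_mat k k \<and> unitary W \<and>
       (\<forall>i<k. c i \<in> \<real>) \<and> ?A = W * diag_mat k c * adj W \<and>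
       B = W * diag_mat k (\<lambda>i. complex_of_real (f (Re (c i)))) * adj W)"
  have dim: "dim_row ?A = k" using U by simp
  have eq: "matfun f ?A = (SOME B. P B)" unfolding matfun_def P_def dim ..
  have "P (herm_diag U k (\<lambda>i. f (d i)))"
    unfolding P_def using U
    by (intro exI[of _ U] exI[of _ "\<lambda>i. complex_of_real (d i)"]) (auto simp: herm_diag_def)
  then have "P (matfun f ?A)" unfolding eq by (rule someI[of P])
  then obtain W c where W: "unitary W" "W \<in> carrier_mat k k" and c: "\<forall>i<k. c i \<in> \<real>"
    and A: "?A = W * diag_mat k c * adj W"
    and B: "matfun f ?A = W * diag_mat k (\<lambda>i. complex_of_real (f (Re (c i)))) * adj W"
    unfolding P_def by blast
  have D: "diag_mat k c = diag_mat k (\<lambda>i. complex_of_real (Re (c i)))"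
    using c by (intro diag_mat_cong) auto
  then have A': "?A = herm_diag W k (\<lambda>i. Re (c i))"
    unfolding A herm_diag_def[of W] by simp
  have "1\<^sub>m k * herm_diag U k (\<lambda>i. f (d i)) = herm_diag W k (\<lambda>i. f (Re (c i))) * 1\<^sub>m k"
    by (rule herm_diag_intertwine[OF U W, where d = d and e = "\<lambda>i. Re (c i)"])
      (use U W A' in \<open>auto simp: right_mult_one_mat[of _ k k] left_mult_one_mat[of _ k k]\<close>)
  then have "herm_diag U k (\<lambda>i. f (d i)) = herm_diag W k (\<lambda>i. f (Re (c i)))"
    using U W by (simp add: right_mult_one_mat[of _ k k] left_mult_one_mat[of _ k k])
  then show ?thesis
    unfolding B by (simp add: herm_diag_def[of W])
qed

lemma index_herm_diag:
  assumes "U \<in> carrier_mat k k" "i < k" "j < k"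
  shows "herm_diag U k d $$ (i,j) = (\<Sum>m<k. U $$ (i,m) * complex_of_real (d m) * cnj (U $$ (j,m)))"
  unfolding herm_diag_def using assms
  by (subst index_mult_mat_sum) (auto simp: index_mult_diag_mat simp del: index_mult_mat(1) intro!: sum.cong)

section \<open>Spectral theorem by deflation\<close>

lemma unitaryI:
  assumes "U \<in> carrier_mat k k"
    and "\<And>i j. i < k \<Longrightarrow> j < k \<Longrightarrow> (\<Sum>m<k. cnj (U $$ (m,i)) * U $$ (m,j)) = (if i = j then 1 else 0)"
  shows "unitary U"
  unfolding unitary_def
proof
  show "adj U * U = 1\<^sub>m (dim_row U)"
    using assms by (intro eq_matI) (auto simp: index_mult_mat_sum simp del: index_mult_mat(1))
qed (use assms in auto)

lemma unitary_mult:
  assumes "unitary U" "unitary V" "U \<in> carrier_mat k k" "V \<in> carrier_mat k k"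
  shows "unitary (U * V)"
  using assms unfolding unitary_def
  by (simp add: adj_mult mult_mat_assoc unitary_cancel[OF assms(1,3)] unitaryD[OF assms(2,4)])

text \<open>The Householder reflection in the direction \<open>v - e\<^sub>0\<close>; taking \<open>v\<^sub>0 \<le> 0\<close> keeps its
  normalisation away from zero.\<close>

lemma householder:
  fixes v :: "nat \<Rightarrow> complex"
  assumes v: "(\<Sum>i<Suc m. v i * cnj (v i)) = 1" and v0: "v 0 = - complex_of_real r" and r: "r \<ge> 0"
  obtains W where "W \<in> carrier_mat (Suc m) (Suc m)" "adj W = W" "W * W = 1\<^sub>m (Suc m)"
    "\<And>i. i < Suc m \<Longrightarrow> W $$ (i,0) = v i"
proof -
  define w where "w i = v i - (if i = 0 then 1 else 0)" for i :: nat
  \<comment> \<open>The normalisation 2/|w|^2 of the reflection along \<open>w\<close>, since |w|^2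
    = 2(1 + \<open>r\<close>).\<close>
  define c where "c = complex_of_real (1 / (1 + r))"
  have rc: "(1 + complex_of_real r) * c = 1"
    using r unfolding c_def by (simp flip: of_real_add add: add_nonneg_eq_0_iff)
       (metis add_nonneg_eq_0_iff of_real_1 of_real_add of_real_eq_0_iff zero_le_one zero_neq_one)
  have cc: "cnj c = c" by (simp add: c_def)
  define W where "W = mat (Suc m) (Suc m) (\<lambda>(i,j). (if i = j then 1 else 0) - c * w i * cnj (w j))"
  have "(\<Sum>i<Suc m. w i * cnj (w i)) = (\<Sum>i<Suc m. v i * cnj (v i)) - v 0 - cnj (v 0) + 1"
    unfolding sum.lessThan_Suc_shift by (simp add: w_def algebra_simps)
  then have ww: "(\<Sum>i<Suc m. w i * cnj (w i)) = 2 * (1 + complex_of_real r)"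
    using v v0 by simp
  have "W * W = 1\<^sub>m (Suc m)"
  proof (rule eq_matI)
    fix i j assume "i < dim_row (1\<^sub>m (Suc m))" "j < dim_col (1\<^sub>m (Suc m))"
    then have ij: "i < Suc m" "j < Suc m" by auto
    let ?\<delta> = "\<lambda>i j. if i = (j::nat) then 1 else (0::complex)"
    have "(W * W) $$ (i,j) = (\<Sum>k<Suc m. (?\<delta> i k - c * w i * cnj (w k)) * (?\<delta> k j - c * w k * cnj (w j)))"
      using ij by (subst index_mult_mat_sum) (auto simp: W_def intro!: sum.cong)
    also have "\<dots> = (\<Sum>k<Suc m. (if k = i then ?\<delta> k j - c * w k * cnj (w j) else 0)
        - (if k = j then c * w i * cnj (w k) else 0) + c * c * w i * cnj (w j) * (w k * cnj (w k)))"
      by (intro sum.cong) (auto simp: algebra_simps)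
    also have "\<dots> = (?\<delta> i j - c * w i * cnj (w j)) - c * w i * cnj (w j)
        + c * c * w i * cnj (w j) * (\<Sum>k<Suc m. w k * cnj (w k))"
      using ij by (simp only: sum.distrib sum_subtractf sum_distrib_left sum.delta finite_lessThan) simp
    also have "\<dots> = ?\<delta> i j + 2 * c * w i * cnj (w j) * ((1 + complex_of_real r) * c - 1)"
      unfolding ww by (simp add: algebra_simps)
    finally show "(W * W) $$ (i,j) = 1\<^sub>m (Suc m) $$ (i,j)"
      using ij rc by simp
  qed (auto simp: W_def)
  moreover have "adj W = W"
    by (rule eq_matI) (auto simp: W_def cc)
  moreover have "W $$ (i,0) = v i" if "i < Suc m" for i
  proof -
    have "W $$ (i,0) = (if i = 0 then 1 else 0) - w i * (c * cnj (w 0))"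
      using that by (auto simp: W_def)
    \<comment> \<open>As \<open>w 0\<close> = -(1 + \<open>r\<close>), this scalar is -1, and the
      first column becomes e_0 + \<open>w\<close> = \<open>v\<close>.\<close>
    also have "c * cnj (w 0) = - ((1 + complex_of_real r) * c)"
      by (simp add: w_def v0 algebra_simps)
    finally show ?thesis unfolding rc by (simp add: w_def)
  qed
  ultimately show ?thesis using that[of W] by (auto simp: W_def)
qed

text \<open>An eigenvector may be multiplied by any phase; the one chosen makes its first coordinate
  a nonpositive real, as the Householder reflection requires.\<close>

lemma eigenvector_normalised:
  fixes A :: "complex mat"
  assumes A: "A \<in> carrier_mat (Suc m) (Suc m)"
  obtains \<mu> v r where "(\<Sum>i<Suc m. v i * cnj (v i)) = 1" "v 0 = - complex_of_real r" "r \<ge> 0"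
    "\<And>i. i < Suc m \<Longrightarrow> (\<Sum>j<Suc m. A $$ (i,j) * v j) = \<mu> * v i"
proof -
  obtain \<mu> where "eigenvalue A \<mu>"
    using spectrum_non_empty[OF A] by (auto simp: spectrum_def)
  then obtain x where x: "x \<in> carrier_vec (Suc m)" "x \<noteq> 0\<^sub>v (Suc m)" "A *\<^sub>v x = \<mu> \<cdot>\<^sub>v x"
    using A by (auto simp: eigenvalue_def eigenvector_def)
  have Ax: "(\<Sum>j<Suc m. A $$ (i,j) * x $ j) = \<mu> * x $ i" if "i < Suc m" for i
  proof -
    have "(A *\<^sub>v x) $ i = (\<Sum>j<Suc m. A $$ (i,j) * x $ j)"
      using that A x(1) unfolding index_mult_mat_vec[of i A x] lessThan_atLeast0
      by (auto simp: scalar_prod_def intro!: sum.cong)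
    then show ?thesis using x that by simp
  qed
  define N where "N = (\<Sum>i<Suc m. (cmod (x $ i))\<^sup>2)"
  obtain i where i: "i < Suc m" "x $ i \<noteq> 0"
    using x by (metis eq_vecI carrier_vecD index_zero_vec(1,2))
  have "0 < (cmod (x $ i))\<^sup>2" using i by simp
  also have "\<dots> \<le> N" unfolding N_def using i
    by (intro member_le_sum) auto
  finally have N: "N > 0" .
  \<comment> \<open>The phase rotates \<open>x $ 0\<close> onto the negative real axis; if that
    coordinate is 0, any phase works and 1 is taken.\<close>
  define \<theta> where "\<theta> = (if x $ 0 = 0 then 1 else - cnj (x $ 0) / complex_of_real (cmod (x $ 0)))"
  have "cmod \<theta> = 1" by (simp add: \<theta>_def norm_divide)
  then have \<theta>: "\<theta> * cnj \<theta> = 1"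
    by (simp flip: complex_norm_square)
  have \<theta>x: "\<theta> * x $ 0 = - complex_of_real (cmod (x $ 0))"
    by (auto simp: \<theta>_def field_simps complex_norm_square[symmetric] power2_eq_square mult.commute[of "cnj _"])
  define v where "v i = \<theta> * x $ i / complex_of_real (sqrt N)" for i
  have "(\<Sum>i<Suc m. v i * cnj (v i)) = (\<Sum>i<Suc m. complex_of_real ((cmod (x $ i))\<^sup>2 / N))"
  proof (rule sum.cong)
    fix i
    have "v i * cnj (v i) = (\<theta> * cnj \<theta>) * (x $ i * cnj (x $ i)) /
        (complex_of_real (sqrt N) * complex_of_real (sqrt N))"
      by (simp add: v_def mult_ac)
    also have "complex_of_real (sqrt N) * complex_of_real (sqrt N) = complex_of_real N"
      using N by (simp flip: of_real_mult)
    finally show "v i * cnj (v i) = complex_of_real ((cmod (x $ i))\<^sup>2 / N)"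
      unfolding \<theta> by (simp only: complex_norm_square[symmetric] mult_1_left of_real_divide)
  qed simp
  also have "\<dots> = complex_of_real (N / N)"
    unfolding N_def by (simp only: of_real_sum[symmetric] sum_divide_distrib)
  finally have 1: "(\<Sum>i<Suc m. v i * cnj (v i)) = 1" using N by simp
  have 2: "v 0 = - complex_of_real (cmod (x $ 0) / sqrt N)"
    by (simp add: v_def \<theta>x)
  have 3: "(\<Sum>j<Suc m. A $$ (i,j) * v j) = \<mu> * v i" if "i < Suc m" for i
  proof -
    have "(\<Sum>j<Suc m. A $$ (i,j) * v j) = \<theta> / complex_of_real (sqrt N) * (\<Sum>j<Suc m. A $$ (i,j) * x $ j)"
      unfolding sum_distrib_left v_def by (intro sum.cong) auto
    then show ?thesis unfolding Ax[OF that] by (simp add: v_def)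
  qed
  show ?thesis using that[OF 1 2 _ 3] N by simp
qed

text \<open>The reflection \<open>W\<close> exchanges a unit eigenvector with the first basis
  vector, so the conjugate \<open>B\<close> of \<open>A\<close> has first column (\<mu>, 0, ..., 0).
  Hermiticity clears the first row as well, and the induction hypothesis diagonalises the remaining
  block.\<close>

theorem spectral_theorem:
  assumes "A \<in> carrier_mat m m" "adj A = A"
  shows "\<exists>U d. unitary U \<and> U \<in> carrier_mat m m \<and> A = herm_diag U m d"
  using assms
proof (induction m arbitrary: A)
  case 0
  then show ?case
    by (intro exI[of _ "1\<^sub>m 0"] exI[of _ "\<lambda>_. 0"]) (auto simp: unitary_def herm_diag_def)
next
  case (Suc m)
  note A = Suc.prems
  obtain \<mu> v r where v: "(\<Sum>i<Suc m. v i * cnj (v i)) = 1" "v 0 = - complex_of_real r" "r \<ge> 0"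
    and Av: "\<And>i. i < Suc m \<Longrightarrow> (\<Sum>j<Suc m. A $$ (i,j) * v j) = \<mu> * v i"
    by (rule eigenvector_normalised[OF A(1)]) blast
  obtain W where W: "W \<in> carrier_mat (Suc m) (Suc m)" "adj W = W" "W * W = 1\<^sub>m (Suc m)"
    and Wv: "\<And>i. i < Suc m \<Longrightarrow> W $$ (i,0) = v i"
    by (rule householder[OF v]) blast
  note [simp] = carrier_matD[OF W(1)] carrier_matD[OF A(1)]
  define B where "B = W * (A * W)"
  have B: "B \<in> carrier_mat (Suc m) (Suc m)" by (auto simp: B_def)
  have B_adj: "adj B = B" by (simp add: B_def adj_mult W A mult_mat_assoc)
  have B_sym: "B $$ (i,j) = cnj (B $$ (j,i))" if "i < Suc m" "j < Suc m" for i j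
    using that B index_adj[of i B j] unfolding B_adj by auto
  have AW0: "(A * W) $$ (k,0) = \<mu> * W $$ (k,0)" if "k < Suc m" for k
    using that Av[of k] Wv by (subst index_mult_mat_sum) (auto simp del: sum.lessThan_Suc)
  have B0: "B $$ (i,0) = (if i = 0 then \<mu> else 0)" if "i < Suc m" for i
  proof -
    have "B $$ (i,0) = (\<Sum>k<Suc m. W $$ (i,k) * (A * W) $$ (k,0))"
      unfolding B_def using that by (subst index_mult_mat_sum) auto
    also have "\<dots> = \<mu> * (\<Sum>k<Suc m. W $$ (i,k) * W $$ (k,0))"
      unfolding sum_distrib_left by (intro sum.cong) (simp_all add: AW0 del: index_mult_mat(1))
    also have "(\<Sum>k<Suc m. W $$ (i,k) * W $$ (k,0)) = (W * W) $$ (i,0)"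
      using that by (subst index_mult_mat_sum) auto
    finally show ?thesis using that W(3) by simp
  qed
  \<comment> \<open>A diagonal entry of the Hermitian matrix \<open>B\<close> is real.\<close>
  have \<mu>: "complex_of_real (Re \<mu>) = \<mu>"
    using B_sym[of 0 0] B0[of 0] by (simp add: complex_eq_iff)
  define A' where "A' = mat m m (\<lambda>(i,j). B $$ (Suc i, Suc j))"
  have "adj A' = A'"
    by (rule eq_matI) (auto simp: A'_def B_sym[symmetric])
  then obtain U' d' where U': "unitary U'" "U' \<in> carrier_mat m m" and A': "A' = herm_diag U' m d'"
    using Suc.IH[of A'] by (auto simp: A'_def)
  \<comment> \<open>The block sum of 1 and \<open>U'\<close>; accordingly \<open>d\<close> lists
    \<mu> before the eigenvalues \<open>d'\<close>.\<close>
  define U1 where "U1 = mat (Suc m) (Suc m) (\<lambda>(i,j). if i = 0 \<or> j = 0 then (if i = j then 1 else 0)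
      else U' $$ (i - 1, j - 1))"
  define d where "d = case_nat (Re \<mu>) d'"
  have U1: "U1 \<in> carrier_mat (Suc m) (Suc m)" by (simp add: U1_def)
  have U'_sum: "(\<Sum>l<m. cnj (U' $$ (l,i)) * U' $$ (l,j)) = (if i = j then 1 else 0)"
    if "i < m" "j < m" for i j
  proof -
    have "(adj U' * U') $$ (i,j) = (\<Sum>l<m. cnj (U' $$ (l,i)) * U' $$ (l,j))"
      using that U' by (subst index_mult_mat_sum) auto
    then show ?thesis using unitaryD(1)[OF U'] that by simp
  qed
  have U1_unitary: "unitary U1"
  proof (rule unitaryI[OF U1])
    fix i j assume "i < Suc m" "j < Suc m"
    then show "(\<Sum>l<Suc m. cnj (U1 $$ (l,i)) * U1 $$ (l,j)) = (if i = j then 1 else 0)"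
      unfolding sum.lessThan_Suc_shift using U'_sum
      by (cases i; cases j) (auto simp: U1_def)
  qed
  have "B = herm_diag U1 (Suc m) d"
  proof (rule eq_matI)
    fix i j assume "i < dim_row (herm_diag U1 (Suc m) d)" "j < dim_col (herm_diag U1 (Suc m) d)"
    then have ij: "i < Suc m" "j < Suc m" using U1 by auto
    have A'_ij: "A' $$ (i,j) = (\<Sum>l<m. U' $$ (i,l) * complex_of_real (d' l) * cnj (U' $$ (j,l)))"
      if "i < m" "j < m" for i j
      unfolding A' using that U' by (intro index_herm_diag)
    show "B $$ (i,j) = herm_diag U1 (Suc m) d $$ (i,j)"
    proof (cases i)
      case 0
      then show ?thesis
        unfolding index_herm_diag[OF U1 ij] sum.lessThan_Suc_shift using ij B0[of j] B_sym[of 0 j] \<mu>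
        by (cases j) (auto simp: U1_def d_def)
    next
      case (Suc i')
      then show ?thesis
        unfolding index_herm_diag[OF U1 ij] sum.lessThan_Suc_shift
        using ij B0[of i] A'_ij[of i' "j - 1"]
        by (cases j) (auto simp: U1_def d_def A'_def)
    qed
  qed (use U1 B in auto)
  moreover have "W * B * W = A"
  proof -
    have "W * B * W = (W * W) * A * (W * W)"
      by (simp add: B_def mult_mat_assoc)
    then show ?thesis using A W by simp
  qed
  ultimately have "A = W * (U1 * diag_mat (Suc m) (\<lambda>i. complex_of_real (d i)) * adj U1) * adj W"
    by (simp add: W(2) herm_diag_def)
  then have "A = herm_diag (W * U1) (Suc m) d"
    using U1 by (simp add: herm_diag_def adj_mult mult_mat_assoc)
  moreover have "unitary (W * U1)"
    using U1 U1_unitary W by (intro unitary_mult[of _ _ "Suc m"]) (auto simp: unitary_def)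
  moreover have "W * U1 \<in> carrier_mat (Suc m) (Suc m)" using U1 by auto
  ultimately show ?case by blast
qed

section \<open>Tensor products and the trace norm\<close>

lemma dim_kron[simp]:
  "dim_row (kron A B) = dim_row A * dim_row B" "dim_col (kron A B) = dim_col A * dim_col B"
  by (auto simp: kron_def)

lemma kron_carrier:
  "A \<in> carrier_mat a b \<Longrightarrow> B \<in> carrier_mat c d \<Longrightarrow> kron A B \<in> carrier_mat (a * c) (b * d)"
  by (rule carrier_matI) auto

lemma index_kron:
  assumes "i < dim_row A * dim_row B" "j < dim_col A * dim_col B"
  shows "kron A B $$ (i,j) = A $$ (i div dim_row B, j div dim_col B) * B $$ (i mod dim_row B, j mod dim_col B)"
  using assms by (simp add: kron_def)

lemma div_mod_less_mult:
  fixes i :: nat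
  assumes "i < a * b"
  shows "i div b < a" "i mod b < b"
proof -
  have "b > 0" using assms by (cases b) auto
  then show "i mod b < b" by simp
  show "i div b < a" using assms by (rule less_mult_imp_div_less)
qed

lemma mult_add_less_mult:
  fixes a b c d :: nat
  assumes "c < a" "d < b"
  shows "c * b + d < a * b"
proof -
  have "c * b + d < Suc c * b" using assms by simp
  also have "\<dots> \<le> a * b" using assms by (intro mult_right_mono) auto
  finally show ?thesis .
qed

text \<open>Serves both for composite tensor indices and for cutting a bit string into two
  blocks.\<close>

lemma sum_div_mod:
  fixes h :: "nat \<Rightarrow> nat \<Rightarrow> 'a :: comm_monoid_add"
  shows "(\<Sum>k<a*b. h (k div b) (k mod b)) = (\<Sum>i<a. \<Sum>j<b. h i j)"
  unfolding sum.cartesian_product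
  by (rule sum.reindex_bij_witness[of _ "\<lambda>(i,j). i * b + j" "\<lambda>k. (k div b, k mod b)"])
     (auto simp: div_mod_less_mult mult_add_less_mult)

lemma kron_mult:
  assumes "dim_col A = dim_row C" "dim_col B = dim_row D"
  shows "kron A B * kron C D = kron (A * C) (B * D)"
proof (rule eq_matI)
  fix i j assume "i < dim_row (kron (A * C) (B * D))" "j < dim_col (kron (A * C) (B * D))"
  then have i: "i < dim_row A * dim_row B" and j: "j < dim_col C * dim_col D" by auto
  let ?i = "i div dim_row B" and ?i' = "i mod dim_row B" and ?j = "j div dim_col D" and ?j' = "j mod dim_col D"
  have "(kron A B * kron C D) $$ (i,j) = (\<Sum>k<dim_row C * dim_row D.
      (\<lambda>k k'. A $$ (?i, k) * B $$ (?i', k') * (C $$ (k, ?j) * D $$ (k', ?j'))) (k div dim_row D) (k mod dim_row D))"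
    using i j assms by (subst index_mult_mat_sum) (auto simp: index_kron intro!: sum.cong)
  also have "\<dots> = (\<Sum>k<dim_row C. \<Sum>k'<dim_row D. A $$ (?i, k) * B $$ (?i', k') * (C $$ (k, ?j) * D $$ (k', ?j')))"
    by (rule sum_div_mod)
  also have "\<dots> = (\<Sum>k<dim_row C. A $$ (?i, k) * C $$ (k, ?j)) * (\<Sum>k'<dim_row D. B $$ (?i', k') * D $$ (k', ?j'))"
    by (simp add: sum_product mult_ac)
  also have "\<dots> = kron (A * C) (B * D) $$ (i,j)"
    using i j assms div_mod_less_mult[OF i] div_mod_less_mult[OF j]
    by (simp add: index_kron index_mult_mat_sum del: index_mult_mat(1))
  finally show "(kron A B * kron C D) $$ (i,j) = kron (A * C) (B * D) $$ (i,j)" .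
qed (auto)

lemma adj_kron: "adj (kron A B) = kron (adj A) (adj B)"
proof (rule eq_matI)
  fix i j assume "i < dim_row (kron (adj A) (adj B))" "j < dim_col (kron (adj A) (adj B))"
  then have i: "i < dim_col A * dim_col B" and j: "j < dim_row A * dim_row B" by auto
  then show "adj (kron A B) $$ (i,j) = kron (adj A) (adj B) $$ (i,j)"
    using div_mod_less_mult[OF i] div_mod_less_mult[OF j] by (simp add: index_kron)
qed auto

lemma div_mod_eq_iff: "(i::nat) = j \<longleftrightarrow> i div b = j div b \<and> i mod b = j mod b"
  by (metis div_mult_mod_eq)

lemma kron_one_diag_mat: "kron (1\<^sub>m a) (diag_mat b f) = diag_mat (a * b) (\<lambda>i. f (i mod b))"
proof (rule eq_matI)
  fix i j assume "i < dim_row (diag_mat (a * b) (\<lambda>i. f (i mod b)))" "j < dim_col (diag_mat (a * b) (\<lambda>i. f (i mod b)))"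
  then have i: "i < a * b" and j: "j < a * b" by auto
  then show "kron (1\<^sub>m a) (diag_mat b f) $$ (i,j) = diag_mat (a * b) (\<lambda>i. f (i mod b)) $$ (i,j)"
    using div_mod_less_mult[OF i] div_mod_less_mult[OF j] div_mod_eq_iff[of i j b]
    by (auto simp: index_kron diag_mat_def)
qed auto

lemma kron_one_one: "kron (1\<^sub>m a) (1\<^sub>m b) = 1\<^sub>m (a * b)"
  using kron_one_diag_mat[of a b "\<lambda>_. 1"] by (simp add: diag_mat_one)

lemma unitary_kron_one:
  assumes "unitary U" "U \<in> carrier_mat b b"
  shows "unitary (kron (1\<^sub>m a) U)"
  using assms unitaryD(1)[OF assms] by (auto simp: unitary_def adj_kron kron_mult kron_one_one)

lemma kron_one_herm_diag:
  assumes "U \<in> carrier_mat b b"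
  shows "kron (1\<^sub>m a) (herm_diag U b d) = herm_diag (kron (1\<^sub>m a) U) (a * b) (\<lambda>i. d (i mod b))"
  using assms kron_one_diag_mat[of a b "\<lambda>i. complex_of_real (d i)", symmetric]
  by (simp add: herm_diag_def adj_kron kron_mult)

lemma tr_kron:
  assumes "dim_row A = dim_col A" "dim_row B = dim_col B"
  shows "tr (kron A B) = tr A * tr B"
proof -
  have "tr (kron A B) = (\<Sum>k<dim_row A * dim_row B.
      (\<lambda>i j. A $$ (i,i) * B $$ (j,j)) (k div dim_row B) (k mod dim_row B))"
    using assms by (auto simp: tr_def index_kron intro!: sum.cong)
  also have "\<dots> = (\<Sum>i<dim_row A. \<Sum>j<dim_row B. A $$ (i,i) * B $$ (j,j))"
    by (rule sum_div_mod)
  also have "\<dots> = tr A * tr B"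
    by (simp add: tr_def sum_product)
  finally show ?thesis .
qed

text \<open>The sign of \<open>M\<close> is a unitary \<open>V\<close> with \<open>V * M\<close> =
  |M|. This turns the trace norm into a trace to which Cauchy-Schwarz applies.\<close>

lemma trace_norm_eq_tr_unitary:
  assumes "M \<in> carrier_mat k k" "adj M = M"
  obtains V where "unitary V" "V \<in> carrier_mat k k" "trace_norm M = Re (tr (V * M))"
proof -
  obtain U d where U: "unitary U" "U \<in> carrier_mat k k" and M: "M = herm_diag U k d"
    using spectral_theorem[OF assms] by blast
  \<comment> \<open>Zero eigenvalues get sign 1 rather than 0, which keeps \<open>V\<close>
    unitary.\<close>
  define V where "V = herm_diag U k (\<lambda>i. if d i \<ge> 0 then 1 else -1)"
  have "msqrt (adj M * M) = herm_diag U k (\<lambda>i. \<bar>d i\<bar>)"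
    unfolding M msqrt_def using U by (simp add: herm_diag_mult matfun_herm_diag)
  also have "\<dots> = V * M"
    unfolding V_def M using U by (simp add: herm_diag_mult) (intro herm_diag_cong, auto)
  finally have "trace_norm M = Re (tr (V * M))" by (simp add: trace_norm_def)
  moreover have "unitary V"
  proof -
    have "herm_diag U k (\<lambda>i. (if d i \<ge> 0 then 1 else -1) * (if d i \<ge> 0 then 1 else -1)) = herm_diag U k (\<lambda>i. 1)"
      by (intro herm_diag_cong) auto
    then show ?thesis
      unfolding V_def unitary_def using U by (simp add: herm_diag_mult herm_diag_one)
  qed
  moreover have "V \<in> carrier_mat k k" using U by (simp add: V_def)
  ultimately show ?thesis using that by blast
qed

text \<open>With \<open>V\<close> the sign unitary, cyclicity makes Tr \<open>V * M\<close> the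
  inner product of \<open>Y\<close> = \<open>Q * adj V * Q\<close> and \<open>X\<close>. One
  Cauchy-Schwarz splits off \<open>X\<close>; a second bounds Tr \<open>adj Y * Y\<close> by Tr
  Q^4.\<close>

lemma trace_norm_weighted_le:
  assumes M: "M \<in> carrier_mat k k" "adj M = M" and Q: "Q \<in> carrier_mat k k" "adj Q = Q"
    and X: "X \<in> carrier_mat k k" and eq: "M = Q * X * Q"
  shows "(trace_norm M)\<^sup>2 \<le> Re (tr (Q * Q * (Q * Q))) * Re (tr (adj X * X))"
proof -
  obtain V where V: "unitary V" "V \<in> carrier_mat k k" "trace_norm M = Re (tr (V * M))"
    by (rule trace_norm_eq_tr_unitary[OF M])
  note [simp] = carrier_matD[OF Q(1)] carrier_matD[OF X] carrier_matD[OF V(2)]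
    unitary_cancel[OF V(1,2)]
  define R where "R = Q * Q"
  have R[simp]: "dim_row R = k" "dim_col R = k" "adj R = R" by (simp_all add: R_def adj_mult Q)
  define Y where "Y = Q * adj V * Q"
  have Y[simp]: "dim_row Y = k" "dim_col Y = k" by (simp_all add: Y_def)
  have adjY: "adj Y = Q * V * Q" by (simp add: Y_def adj_mult Q mult_mat_assoc)
  have "tr (V * M) = tr ((V * (Q * X)) * Q)" by (simp add: eq mult_mat_assoc)
  also have "\<dots> = tr (adj Y * X)"
    by (subst tr_mult_commute) (simp_all add: adjY mult_mat_assoc)
  finally have "trace_norm M = Re (tr (adj Y * X))" using V by simp
  then have "(trace_norm M)\<^sup>2 \<le> (cmod (tr (adj Y * X)))\<^sup>2"
    using abs_Re_le_cmod[of "tr (adj Y * X)"] by (simp add: abs_le_square_iff[symmetric])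
  also have "\<dots> \<le> Re (tr (adj Y * Y)) * Re (tr (adj X * X))"
    by (rule tr_Cauchy_Schwarz) auto
  also have "\<dots> \<le> Re (tr (R * R)) * Re (tr (adj X * X))"
  proof (rule mult_right_mono[OF _ Re_tr_adj_mult_self_nonneg])
    \<comment> \<open>Tr \<open>adj Y * Y\<close> is the inner product of \<open>R\<close> with its
      unitary conjugate \<open>Z\<close>, which has the same Hilbert-Schmidt norm.\<close>
    define Z where "Z = V * R * adj V"
    have Z[simp]: "dim_row Z = k" "dim_col Z = k" by (simp_all add: Z_def)
    have "tr (adj Y * Y) = tr (Q * (V * R * adj V * Q))"
      unfolding adjY by (simp add: Y_def R_def mult_mat_assoc)
    also have "\<dots> = tr (Z * R)"
      by (subst tr_mult_commute) (simp_all add: Z_def R_def mult_mat_assoc)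
    also have "\<dots> = tr (adj R * Z)"
      by (subst tr_mult_commute) simp_all
    finally have "(Re (tr (adj Y * Y)))\<^sup>2 \<le> (cmod (tr (adj R * Z)))\<^sup>2"
      using abs_Re_le_cmod[of "tr (adj R * Z)"] by (simp add: abs_le_square_iff[symmetric])
    also have "\<dots> \<le> Re (tr (adj R * R)) * Re (tr (adj Z * Z))"
      by (rule tr_Cauchy_Schwarz) auto
    also have "tr (adj Z * Z) = tr (V * (R * (R * adj V)))"
      by (simp add: Z_def adj_mult mult_mat_assoc)
    also have "\<dots> = tr (R * R)"
      by (subst tr_mult_commute) (simp_all add: mult_mat_assoc unitaryD[OF V(1,2)]
          right_mult_one_mat[of R k k] carrier_matI)
    finally have "(Re (tr (adj Y * Y)))\<^sup>2 \<le> (Re (tr (R * R)))\<^sup>2"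
      by (simp add: power2_eq_square)
    then show "Re (tr (adj Y * Y)) \<le> Re (tr (R * R))"
      by (rule power2_le_imp_le) (use Re_tr_adj_mult_self_nonneg[of R] in simp)
  qed
  finally show ?thesis by (simp add: R_def)
qed

text \<open>The quadratic form at the \<open>i\<close>-th column of \<open>U\<close> takes the value
  \<open>d i\<close>.\<close>

lemma psd_herm_diag_nonneg:
  assumes "psd (herm_diag U k d)" and U: "unitary U" "U \<in> carrier_mat k k" and i: "i < k"
  shows "d i \<ge> 0"
proof -
  let ?A = "herm_diag U k d" and ?v = "col U i"
  have row: "row (adj U) i = conjugate ?v" using U i by (intro eq_vecI) auto
  have "conjugate ?v \<bullet> (?A *\<^sub>v ?v) = (adj U * (?A * U)) $$ (i,i)"
    using U i by (simp add: row col_mult2[of _ k k])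
  also have "adj U * (?A * U) = diag_mat k (\<lambda>i. complex_of_real (d i))"
    using U by (simp add: herm_diag_def mult_mat_assoc unitary_cancel unitaryD
       right_mult_one_mat[of _ k k])
  finally have "conjugate ?v \<bullet> (?A *\<^sub>v ?v) = complex_of_real (d i)"
    using i by (simp add: diag_mat_def)
  then show ?thesis
    using assms unfolding psd_def by (metis Re_complex_of_real carrier_matD(1) dim_col dim_herm_diag(1))
qed

text \<open>The factor is the positive square root. It later makes the overlaps Tr X F_\<beta>(X)
  nonnegative.\<close>

lemma psd_factorisation:
  assumes "psd A" "A \<in> carrier_mat k k"
  obtains K where "K \<in> carrier_mat k k" "A = K * adj K"
proof -
  have "adj A = A" using assms by (auto simp: psd_def hermitian_def)
  then obtain U d where U: "unitary U" "U \<in> carrier_mat k k" and A: "A = herm_diag U k d"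
    using spectral_theorem assms by blast
  have d: "d i \<ge> 0" if "i < k" for i
    using assms that U unfolding A by (auto intro: psd_herm_diag_nonneg)
  have "A = herm_diag U k (\<lambda>i. sqrt (d i) * sqrt (d i))"
    unfolding A by (intro herm_diag_cong) (auto simp: d)
  then have "A = herm_diag U k (\<lambda>i. sqrt (d i)) * adj (herm_diag U k (\<lambda>i. sqrt (d i)))"
    using U by (simp add: herm_diag_mult)
  then show ?thesis using U that[of "herm_diag U k (\<lambda>i. sqrt (d i))"] by auto
qed

section \<open>Pauli operators\<close>

lemma xor_nat_less_power2:
  fixes a b :: nat
  assumes "a < 2 ^ n" "b < 2 ^ n"
  shows "xor a b < 2 ^ n"
  using assms by (simp flip: take_bit_nat_eq_self_iff)

lemma div_power2_less:
  fixes \<beta> :: nat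
  assumes "\<beta> < 2 ^ (2 * n)"
  shows "\<beta> div 2 ^ n < 2 ^ n"
  using assms by (intro less_mult_imp_div_less) (simp flip: power_add add: mult_2)

lemma xor_nat_inject: "xor a s = xor b s \<longleftrightarrow> a = (b :: nat)"
  by (metis xor.assoc xor.right_neutral xor_self_eq)

text \<open>XOR with \<open>c\<close> is an involution of the \<open>n\<close>-bit strings, so it
  only permutes the summands.\<close>

lemma sum_xor_shift:
  fixes h :: "nat \<Rightarrow> 'a :: comm_monoid_add"
  assumes "c < 2 ^ n"
  shows "(\<Sum>x<2 ^ n. h (xor x c)) = (\<Sum>x<2 ^ n. h x)"
  by (rule sum.reindex_bij_witness[of _ "\<lambda>x. xor x c" "\<lambda>x. xor x c"])
     (auto simp: xor.assoc xor_nat_less_power2 assms)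

text \<open>The character (-1)^(q.j) of the group of \<open>n\<close>-bit strings; bits from
  position \<open>n\<close> on are ignored.\<close>

definition bit_char :: "nat \<Rightarrow> nat \<Rightarrow> nat \<Rightarrow> complex" where
  "bit_char n q j = (\<Prod>b<n. if bit q b \<and> bit j b then -1 else 1)"

lemma bit_char_xor_right: "bit_char n q (xor i j) = bit_char n q i * bit_char n q j"
  unfolding bit_char_def prod.distrib[symmetric] by (intro prod.cong) (auto simp: bit_xor_iff)

lemma bit_char_xor_left: "bit_char n (xor p q) j = bit_char n p j * bit_char n q j"
  unfolding bit_char_def prod.distrib[symmetric] by (intro prod.cong) (auto simp: bit_xor_iff)

lemma bit_char_square: "bit_char n q j * bit_char n q j = 1"
  unfolding bit_char_def prod.distrib[symmetric] by (intro prod.neutral) auto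

lemma bit_char_zero[simp]: "bit_char n q 0 = 1"
  by (simp add: bit_char_def)

lemma cnj_bit_char[simp]: "cnj (bit_char n q j) = bit_char n q j"
  unfolding bit_char_def cnj_prod by (intro prod.cong) auto

lemma bit_char_take_bit: "bit_char n q (take_bit n j) = bit_char n q j"
  unfolding bit_char_def by (intro prod.cong) (auto simp: bit_take_bit_iff)

text \<open>Orthogonality of characters: if \<open>c\<close> has a bit set at \<open>b\<close>,
  flipping bit \<open>b\<close> of \<open>q\<close> permutes the summands and negates each, so the
  sum equals its own negative.\<close>

lemma sum_bit_char:
  assumes "c < 2 ^ n"
  shows "(\<Sum>q<2 ^ n. bit_char n q c) = (if c = 0 then 2 ^ n else 0)"
proof (cases "c = 0")
  case False
  then obtain b where b: "bit c b" using bit_eqI[of c 0] by auto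
  have bn: "b < n" using assms b
    by (metis bit_take_bit_iff take_bit_nat_eq_self_iff)
  have "bit_char n (2 ^ b) c = (\<Prod>i<n. if i = b then -1 else 1)"
    unfolding bit_char_def using b by (intro prod.cong) (auto simp: bit_exp_iff)
  then have neg: "bit_char n (2 ^ b) c = -1" using bn by simp
  have "(\<Sum>q<2 ^ n. bit_char n q c) = (\<Sum>q<2 ^ n. bit_char n (xor q (2 ^ b)) c)"
    using bn by (intro sum_xor_shift[symmetric]) simp
  also have "\<dots> = - (\<Sum>q<2 ^ n. bit_char n q c)"
    by (simp add: bit_char_xor_left neg sum_negf)
  finally show ?thesis using False by simp
qed simp

definition pauli_factor :: "nat \<Rightarrow> nat \<Rightarrow> nat \<Rightarrow> complex mat" where
  "pauli_factor s q b = (if bit s b then pauliX else 1\<^sub>m 2) * (if bit q b then pauliZ else 1\<^sub>m 2)"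

text \<open>The same tensor product by recursion on the number of qubits. The leftmost factor
  carries the most significant bit, so removing it leaves \<open>s\<close> and \<open>q\<close>
  unchanged.\<close>

fun pauli_tensor :: "nat \<Rightarrow> nat \<Rightarrow> nat \<Rightarrow> complex mat" where
  "pauli_tensor s q 0 = 1\<^sub>m 1"
| "pauli_tensor s q (Suc n) = kron (pauli_factor s q n) (pauli_tensor s q n)"

lemma pauli_op_eq_tensor: "pauli_op n \<beta> = pauli_tensor (\<beta> div 2 ^ n) (\<beta> mod 2 ^ n) n"
proof -
  have "tensor_list (map (\<lambda>i. pauli_factor s q (n - i)) [1..<n+1]) = pauli_tensor s q n" for s q
  proof (induction n)
    case (Suc n)
    \<comment> \<open>Position \<open>Suc i\<close> of \<open>Suc n\<close> uses bit
      \<open>n - i\<close>, so the tail of the list is exactly the list for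
      \<open>n\<close>.\<close>
    have "[1..<Suc n + 1] = 1 # map Suc [1..<n+1]"
      by (simp add: map_Suc_upt upt_conv_Cons)
    then show ?case using Suc by (simp add: comp_def)
  qed simp
  then show ?thesis by (simp add: pauli_op_def pauli_factor_def)
qed

lemma dim_pauliX[simp]: "dim_row pauliX = 2" "dim_col pauliX = 2"
  by (simp_all add: pauliX_def)

lemma dim_pauliZ[simp]: "dim_row pauliZ = 2" "dim_col pauliZ = 2"
  by (simp_all add: pauliZ_def)

lemma dim_pauli_factor[simp]: "dim_row (pauli_factor s q b) = 2" "dim_col (pauli_factor s q b) = 2"
  by (simp_all add: pauli_factor_def)

lemma dim_pauli_tensor[simp]: "dim_row (pauli_tensor s q n) = 2 ^ n" "dim_col (pauli_tensor s q n) = 2 ^ n"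
  by (induction n) auto

lemma index_pauli_factor:
  "pauli_factor s q b $$ (of_bool x, of_bool y) =
    (if x = (y \<noteq> bit s b) then (if bit q b \<and> y then -1 else 1) else 0)"
proof -
  have sum2: "(\<Sum>k<2. f k) = f 0 + f 1" for f :: "nat \<Rightarrow> complex"
    by (simp add: numeral_2_eq_2)
  have "pauli_factor s q b $$ (of_bool x, of_bool y) = (\<Sum>k<2.
      (if bit s b then pauliX else 1\<^sub>m 2) $$ (of_bool x, k) * (if bit q b then pauliZ else 1\<^sub>m 2) $$ (k, of_bool y))"
    unfolding pauli_factor_def by (subst index_mult_mat_sum) auto
  then show ?thesis
    unfolding sum2 by (cases x; cases y) (simp_all add: pauliX_def pauliZ_def)
qed

text \<open>Z acts before X: the sign is read off the column index \<open>j\<close>, and then X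
  moves basis vector \<open>j\<close> to \<open>xor j s\<close> on the low \<open>n\<close>
  bits.\<close>

lemma index_pauli_tensor:
  assumes "i < 2 ^ n" "j < 2 ^ n"
  shows "pauli_tensor s q n $$ (i,j) =
    (if \<forall>b<n. bit i b = (bit j b \<noteq> bit s b) then bit_char n q j else 0)"
  using assms
proof (induction n arbitrary: i j)
  case 0
  then show ?case by (simp add: bit_char_def)
next
  case (Suc n)
  have top: "k div 2 ^ n = of_bool (bit k n)" if "k < 2 ^ Suc n" for k :: nat
  proof -
    have "k div 2 ^ n < 2" using that by (simp add: less_mult_imp_div_less)
    then show ?thesis by (auto simp: bit_iff_odd less_2_cases_iff)
  qed
  have low: "bit (k mod 2 ^ n) b = bit k b" if "b < n" for k b :: nat
    using that by (simp add: bit_take_bit_iff flip: take_bit_eq_mod)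
  have low_all: "(\<forall>b<n. bit (i mod 2 ^ n) b = (bit (j mod 2 ^ n) b \<noteq> bit s b)) \<longleftrightarrow>
      (\<forall>b<n. bit i b = (bit j b \<noteq> bit s b))"
    by (intro all_cong) (simp add: low)
  have "pauli_tensor s q (Suc n) $$ (i,j) =
      pauli_factor s q n $$ (of_bool (bit i n), of_bool (bit j n)) *
      pauli_tensor s q n $$ (i mod 2 ^ n, j mod 2 ^ n)"
    using Suc.prems by (simp add: index_kron top)
  also have "pauli_tensor s q n $$ (i mod 2 ^ n, j mod 2 ^ n) =
      (if \<forall>b<n. bit i b = (bit j b \<noteq> bit s b) then bit_char n q j else 0)"
    using Suc.IH[of "i mod 2 ^ n" "j mod 2 ^ n"]
    unfolding low_all bit_char_take_bit[unfolded take_bit_eq_mod] by simp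
  finally show ?case
    unfolding index_pauli_factor by (auto simp: bit_char_def less_Suc_eq)
qed

text \<open>The permutation of composite indices induced by X^s on system A; the E part
  \<open>i mod d\<close> stays fixed.\<close>

definition shift_A :: "nat \<Rightarrow> nat \<Rightarrow> nat \<Rightarrow> nat" where
  "shift_A d s i = xor (i div d) s * d + i mod d"

lemma shift_A_div_mod[simp]:
  assumes "d > 0"
  shows "shift_A d s i div d = xor (i div d) s" "shift_A d s i mod d = i mod d"
  using assms by (simp_all add: shift_A_def)

lemma shift_A_less:
  assumes "i < 2 ^ n * d" "s < 2 ^ n"
  shows "shift_A d s i < 2 ^ n * d"
  unfolding shift_A_def using assms
  by (intro mult_add_less_mult xor_nat_less_power2 div_mod_less_mult)

lemma shift_A_shift_A: "d > 0 \<Longrightarrow> shift_A d s (shift_A d t i) = shift_A d (xor s t) i"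
  unfolding shift_A_def[of d s] shift_A_def[of d "xor s t"] by (simp add: xor.assoc xor.commute)

lemma shift_A_zero[simp]: "shift_A d 0 i = i"
  by (simp add: shift_A_def)

lemma index_pauli_kron_one:
  assumes \<beta>: "\<beta> < 2 ^ (2 * n)" and i: "i < 2 ^ n * d" and j: "j < 2 ^ n * d"
  shows "kron (pauli_op n \<beta>) (1\<^sub>m d) $$ (i,j) =
    (if j = shift_A d (\<beta> div 2 ^ n) i then bit_char n (\<beta> mod 2 ^ n) (j div d) else 0)"
proof -
  let ?s = "\<beta> div 2 ^ n"
  have s: "?s < 2 ^ n" using \<beta> by (simp add: div_power2_less)
  have d: "d > 0" using i by (cases d) auto
  note ij = div_mod_less_mult[OF i] div_mod_less_mult[OF j]
  have bits: "(\<forall>b<n. bit (i div d) b = (bit (j div d) b \<noteq> bit ?s b)) \<longleftrightarrow> j div d = xor (i div d) ?s"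
  proof
    assume *: "\<forall>b<n. bit (i div d) b = (bit (j div d) b \<noteq> bit ?s b)"
    have "take_bit n (j div d) = take_bit n (xor (i div d) ?s)"
      using * by (intro bit_eqI) (auto simp: bit_take_bit_iff bit_xor_iff)
    then show "j div d = xor (i div d) ?s"
      using ij s by (metis take_bit_nat_eq_self xor_nat_less_power2)
  qed (auto simp: bit_xor_iff)
  have "j = shift_A d ?s i \<longleftrightarrow> j div d = xor (i div d) ?s \<and> i mod d = j mod d"
    using d by (subst div_mod_eq_iff[of _ _ d]) auto
  then show ?thesis
    using i j ij bits by (auto simp: index_kron pauli_op_eq_tensor index_pauli_tensor)
qed

lemma dim_pauli_op[simp]: "dim_row (pauli_op n \<beta>) = 2 ^ n" "dim_col (pauli_op n \<beta>) = 2 ^ n"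
  by (simp_all add: pauli_op_eq_tensor)

lemma dim_F_op[simp]: "dim_row (F_op n d \<beta> \<rho>) = 2 ^ n * d" "dim_col (F_op n d \<beta> \<rho>) = 2 ^ n * d"
  by (simp_all add: F_op_def)

lemma F_op_carrier[simp]: "F_op n d \<beta> \<rho> \<in> carrier_mat (2 ^ n * d) (2 ^ n * d)"
  by (rule carrier_matI) auto

text \<open>Each row and column of a Pauli operator has a single nonzero entry, so both matrix
  products collapse. The sign contributed by the shift occurs on both sides and squares to
  1.\<close>

lemma index_F_op:
  assumes \<beta>: "\<beta> < 2 ^ (2 * n)" and i: "i < 2 ^ n * d" and j: "j < 2 ^ n * d"
    and \<rho>: "\<rho> \<in> carrier_mat (2 ^ n * d) (2 ^ n * d)"
  shows "F_op n d \<beta> \<rho> $$ (i,j) = bit_char n (\<beta> mod 2 ^ n) (xor (i div d) (j div d)) *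
    \<rho> $$ (shift_A d (\<beta> div 2 ^ n) i, shift_A d (\<beta> div 2 ^ n) j)"
proof -
  let ?s = "\<beta> div 2 ^ n" and ?q = "\<beta> mod 2 ^ n" and ?N = "2 ^ n * d"
  let ?K = "kron (pauli_op n \<beta>) (1\<^sub>m d)"
  let ?c = "\<lambda>i. bit_char n ?q (shift_A d ?s i div d)"
  have s: "?s < 2 ^ n" using \<beta> by (simp add: div_power2_less)
  have d: "d > 0" using i by (cases d) auto
  have K\<rho>: "(?K * \<rho>) $$ (i,k) = ?c i * \<rho> $$ (shift_A d ?s i, k)" if "k < ?N" for k
  proof -
    have "(?K * \<rho>) $$ (i,k) = (\<Sum>m<?N. ?K $$ (i,m) * \<rho> $$ (m,k))"
      using \<rho> i that by (subst index_mult_mat_sum) auto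
    also have "\<dots> = (\<Sum>m<?N. if m = shift_A d ?s i then ?c i * \<rho> $$ (shift_A d ?s i, k) else 0)"
      by (intro sum.cong) (auto simp: index_pauli_kron_one[OF \<beta> i])
    finally show ?thesis using shift_A_less[OF i s] by simp
  qed
  have "F_op n d \<beta> \<rho> $$ (i,j) = (\<Sum>k<?N. (?K * \<rho>) $$ (i,k) * adj ?K $$ (k,j))"
    unfolding F_op_def using \<rho> i j by (subst index_mult_mat_sum) auto
  also have "\<dots> = (\<Sum>k<?N. if k = shift_A d ?s j
      then ?c i * \<rho> $$ (shift_A d ?s i, shift_A d ?s j) * ?c j else 0)"
    using j by (intro sum.cong) (auto simp: K\<rho> index_pauli_kron_one[OF \<beta> j] simp del: index_mult_mat(1))
  also have "\<dots> = ?c i * \<rho> $$ (shift_A d ?s i, shift_A d ?s j) * ?c j"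
    using shift_A_less[OF j s] by simp
  also have "\<dots> = bit_char n ?q (i div d) * bit_char n ?q (j div d) *
      (bit_char n ?q ?s * bit_char n ?q ?s) * \<rho> $$ (shift_A d ?s i, shift_A d ?s j)"
    using d by (simp add: bit_char_xor_right)
  finally show ?thesis by (simp add: bit_char_square bit_char_xor_right)
qed

text \<open>Pauli operators compose only up to a sign, which conjugation discards. In entries: the
  character depends on the XOR of the two A indices, and a common shift does not change it.\<close>

lemma F_op_F_op:
  assumes "\<beta> < 2 ^ (2 * n)" "\<gamma> < 2 ^ (2 * n)" "\<rho> \<in> carrier_mat (2 ^ n * d) (2 ^ n * d)"
  shows "F_op n d \<beta> (F_op n d \<gamma> \<rho>) = F_op n d (xor \<beta> \<gamma>) \<rho>"
proof (rule eq_matI)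
  fix i j assume "i < dim_row (F_op n d (xor \<beta> \<gamma>) \<rho>)" "j < dim_col (F_op n d (xor \<beta> \<gamma>) \<rho>)"
  then have ij: "i < 2 ^ n * d" "j < 2 ^ n * d" by auto
  then have d: "d > 0" by (cases d) auto
  have s: "\<beta> div 2 ^ n < 2 ^ n" using assms by (simp add: div_power2_less)
  have dv: "xor \<beta> \<gamma> div 2 ^ n = xor (\<beta> div 2 ^ n) (\<gamma> div 2 ^ n)"
    by (simp flip: drop_bit_eq_div)
  have md: "xor \<beta> \<gamma> mod 2 ^ n = xor (\<beta> mod 2 ^ n) (\<gamma> mod 2 ^ n)"
    by (simp flip: take_bit_eq_mod)
  have x: "xor (xor a s) (xor b s) = xor a b" for a b s :: nat
    by (rule bit_eqI) (auto simp: bit_xor_iff)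
  show "F_op n d \<beta> (F_op n d \<gamma> \<rho>) $$ (i,j) = F_op n d (xor \<beta> \<gamma>) \<rho> $$ (i,j)"
    using assms ij d by (simp add: index_F_op shift_A_less s xor_nat_less_power2 dv md x
        shift_A_shift_A bit_char_xor_left xor.commute)
qed auto

lemma unitary_pauli_kron_one:
  assumes "\<beta> < 2 ^ (2 * n)"
  shows "unitary (kron (pauli_op n \<beta>) (1\<^sub>m d))"
proof -
  let ?K = "kron (pauli_op n \<beta>) (1\<^sub>m d)" and ?N = "2 ^ n * d"
  have K: "?K \<in> carrier_mat ?N ?N" by (rule carrier_matI) auto
  have s: "\<beta> div 2 ^ n < 2 ^ n" using assms by (simp add: div_power2_less)
  \<comment> \<open>Conjugating the identity yields \<open>?K * adj ?K\<close>, so the entry formula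
    proves unitarity without multiplying out.\<close>
  have "F_op n d \<beta> (1\<^sub>m ?N) = 1\<^sub>m ?N"
  proof (rule eq_matI)
    fix i j assume "i < dim_row (1\<^sub>m ?N :: complex mat)" "j < dim_col (1\<^sub>m ?N :: complex mat)"
    then have ij: "i < ?N" "j < ?N" by auto
    then have d: "d > 0" by (cases d) auto
    have "shift_A d (\<beta> div 2 ^ n) i = shift_A d (\<beta> div 2 ^ n) j \<longleftrightarrow> i = j"
      using d by (subst (1 2) div_mod_eq_iff[of _ _ d]) (simp add: xor_nat_inject)
    then show "F_op n d \<beta> (1\<^sub>m ?N) $$ (i,j) = 1\<^sub>m ?N $$ (i,j)"
      using ij assms by (auto simp: index_F_op shift_A_less s)
  qed auto
  then have "?K * adj ?K = 1\<^sub>m ?N"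
    unfolding F_op_def using K by simp
  then have "adj ?K * ?K = 1\<^sub>m ?N"
    using mat_mult_left_right_inverse[OF K adj_carrier[OF K]] by blast
  then show ?thesis unfolding unitary_def by simp
qed

text \<open>The sum over \<open>q\<close> kills every entry off the A diagonal by orthogonality of
  characters; the sum over \<open>s\<close> then runs through all diagonal blocks and produces the
  partial trace.\<close>

lemma F_op_twirl:
  assumes \<rho>: "\<rho> \<in> carrier_mat (2 ^ n * d) (2 ^ n * d)" and i: "i < 2 ^ n * d" and j: "j < 2 ^ n * d"
  shows "(\<Sum>\<beta><2 ^ (2 * n). F_op n d \<beta> \<rho> $$ (i,j)) =
    2 ^ (2 * n) * kron (maxmixed (2 ^ n)) (ptrace_A (2 ^ n) d \<rho>) $$ (i,j)"
proof -
  let ?a = "i div d" and ?a' = "j div d" and ?e = "i mod d" and ?e' = "j mod d"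
  note ij = div_mod_less_mult[OF i] div_mod_less_mult[OF j]
  have x: "xor ?a ?a' < 2 ^ n" by (rule xor_nat_less_power2) (use ij in auto)
  have x0: "xor ?a ?a' = 0 \<longleftrightarrow> ?a = ?a'"
    using xor_nat_inject[of ?a ?a' ?a'] by simp
  have p: "(2 :: nat) ^ (2 * n) = 2 ^ n * 2 ^ n" by (simp flip: power_add add: mult_2)
  have "(\<Sum>\<beta><2 ^ (2 * n). F_op n d \<beta> \<rho> $$ (i,j)) = (\<Sum>\<beta><2 ^ n * 2 ^ n.
      (\<lambda>s q. bit_char n q (xor ?a ?a') * \<rho> $$ (shift_A d s i, shift_A d s j)) (\<beta> div 2 ^ n) (\<beta> mod 2 ^ n))"
    unfolding p using \<rho> i j by (intro sum.cong) (auto simp: index_F_op p)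
  also have "\<dots> = (\<Sum>s<2 ^ n. \<Sum>q<2 ^ n. bit_char n q (xor ?a ?a') * \<rho> $$ (shift_A d s i, shift_A d s j))"
    by (rule sum_div_mod)
  also have "\<dots> = (if ?a = ?a' then 2 ^ n else 0) * (\<Sum>s<2 ^ n. \<rho> $$ (shift_A d s i, shift_A d s j))"
    by (simp add: sum_bit_char[OF x] x0 sum_distrib_left flip: sum_distrib_right)
  also have "\<dots> = (if ?a = ?a' then 2 ^ n else 0) * (\<Sum>s<2 ^ n. \<rho> $$ (s * d + ?e, s * d + ?e'))"
  proof (cases "?a = ?a'")
    case True
    have "(\<Sum>s<2 ^ n. \<rho> $$ (shift_A d s i, shift_A d s j)) =
        (\<Sum>s<2 ^ n. (\<lambda>s. \<rho> $$ (s * d + ?e, s * d + ?e')) (xor s ?a))"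
      by (simp add: shift_A_def True xor.commute)
    also have "\<dots> = (\<Sum>s<2 ^ n. \<rho> $$ (s * d + ?e, s * d + ?e'))"
      by (rule sum_xor_shift) (use ij in auto)
    finally show ?thesis by simp
  qed simp
  also have "\<dots> = 2 ^ (2 * n) * kron (maxmixed (2 ^ n)) (ptrace_A (2 ^ n) d \<rho>) $$ (i,j)"
    using i j ij by (simp add: index_kron maxmixed_def ptrace_A_def mult_2 power_add)
  finally show ?thesis .
qed

section \<open>Arithmetic in \<open>GF(2\<^sup>\<lambda>)\<close>\<close>

lemma coeff_poly_of_bits: "coeff (poly_of_bits w) i = of_bool (bit w i)"
proof -
  \<comment> \<open>Cutting the coefficient list at length \<open>w + 1\<close> loses nothing, since
    \<open>w < 2 ^ i\<close> for all larger \<open>i\<close>.\<close>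
  have "\<not> bit w i" if "i \<ge> w + 1"
  proof -
    have "w < 2 ^ i" using that less_exp[of i] by linarith
    then show ?thesis by (simp add: bit_iff_odd)
  qed
  then show ?thesis
    unfolding poly_of_bits_def coeff_Poly_eq
    by (cases "i < w + 1") (auto simp: nth_default_nth nth_default_beyond simp del: upt_Suc)
qed

lemma bit_bits_of_poly: "bit (bits_of_poly p) i \<longleftrightarrow> coeff p i = 1"
proof -
  have "bits_of_poly p = horner_sum of_bool 2 (map (\<lambda>i. coeff p i = 1) [0..<Suc (degree p)])"
    unfolding horner_sum_eq_sum bits_of_poly_def
    by (intro sum.cong) (auto simp del: upt_Suc)
  then show ?thesis
    by (cases "i \<le> degree p") (simp_all add: bit_horner_sum_bit_iff coeff_eq_0 nth_map_upt del: upt_Suc)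
qed

lemma bits_of_poly_of_bits: "bits_of_poly (poly_of_bits w) = w"
  by (rule bit_eqI) (simp add: bit_bits_of_poly coeff_poly_of_bits)

lemma poly_of_bits_inject: "poly_of_bits a = poly_of_bits b \<longleftrightarrow> a = b"
  by (metis bits_of_poly_of_bits)

lemma poly_of_bits_of_poly: "poly_of_bits (bits_of_poly p) = p"
proof (rule poly_eqI)
  fix i show "coeff (poly_of_bits (bits_of_poly p)) i = coeff p i"
    by (cases "coeff p i") (simp_all add: bit_bits_of_poly coeff_poly_of_bits)
qed

lemma poly_of_bits_zero[simp]: "poly_of_bits 0 = 0"
  by (rule poly_eqI) (simp add: coeff_poly_of_bits)

lemma poly_of_bits_xor: "poly_of_bits (xor a b) = poly_of_bits a + poly_of_bits b"
  by (rule poly_eqI) (auto simp: coeff_poly_of_bits bit_xor_iff)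

lemma bits_of_poly_add: "bits_of_poly (p + q) = xor (bits_of_poly p) (bits_of_poly q)"
  by (metis bits_of_poly_of_bits poly_of_bits_of_poly poly_of_bits_xor)

lemma bits_of_poly_less:
  assumes "degree p < m"
  shows "bits_of_poly p < 2 ^ m"
proof -
  have "take_bit m (bits_of_poly p) = bits_of_poly p"
    using assms coeff_eq_0[of p]
    by (intro bit_eqI) (auto simp: bit_take_bit_iff bit_bits_of_poly, metis order.strict_trans2 linorder_not_less zero_neq_one)
  then show ?thesis by (simp add: take_bit_nat_eq_self_iff)
qed

lemma degree_poly_of_bits_less:
  assumes "w < 2 ^ m" "0 < m"
  shows "degree (poly_of_bits w) < m"
proof (rule degree_lessI)
  show "\<forall>k\<ge>m. coeff (poly_of_bits w) k = 0"
    using assms by (metis bit_take_bit_iff coeff_poly_of_bits linorder_not_less of_bool_eq(1) take_bit_nat_eq_self_iff)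
qed (use assms in auto)

lemma gf_mult_xor: "gf_mult P u (xor j k) = xor (gf_mult P u j) (gf_mult P u k)"
  by (simp add: gf_mult_def poly_of_bits_xor distrib_left poly_mod_add_left bits_of_poly_add)

lemma gf_mult_zero: "gf_mult P u 0 = 0"
  by (simp add: gf_mult_def bits_of_poly_def)

lemma gf_mult_less:
  assumes "degree P > 0"
  shows "gf_mult P u k < 2 ^ degree P"
proof -
  have "P \<noteq> 0" using assms by auto
  then show ?thesis
    unfolding gf_mult_def using assms degree_mod_less[of P "poly_of_bits u * poly_of_bits k"]
    by (intro bits_of_poly_less) auto
qed

text \<open>If two products agree, the prime \<open>P\<close> divides (u - w)k. It does not divide
  the nonzero \<open>k\<close> of smaller degree, so it divides u - w, which has smaller degree too
  and must vanish.\<close>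

lemma inj_on_gf_mult:
  assumes P: "irreducible P" "degree P > 0" and k: "0 < k" "k < 2 ^ degree P"
  shows "inj_on (\<lambda>u. gf_mult P u k) {..<2 ^ degree P}"
proof (rule inj_onI)
  fix u w assume u: "u \<in> {..<2 ^ degree P}" and w: "w \<in> {..<2 ^ degree P}"
    and eq: "gf_mult P u k = gf_mult P w k"
  let ?p = poly_of_bits
  have "(?p u * ?p k) mod P = (?p w * ?p k) mod P"
    using eq unfolding gf_mult_def by (metis poly_of_bits_of_poly)
  then have "P dvd ?p u * ?p k - ?p w * ?p k"
    by (simp add: mod_eq_dvd_iff)
  then have "P dvd (?p u - ?p w) * ?p k" by (simp add: left_diff_distrib)
  moreover have "prime_elem P" using P by (intro field_poly_irreducible_imp_prime)
  ultimately have "P dvd ?p u - ?p w \<or> P dvd ?p k" by (simp add: prime_elem_dvd_mult_iff)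
  moreover have "\<not> P dvd ?p k"
  proof
    assume "P dvd ?p k"
    moreover have "?p k \<noteq> 0" using k poly_of_bits_inject[of k 0] by simp
    ultimately have "degree P \<le> degree (?p k)" by (rule dvd_imp_degree_le)
    then show False using degree_poly_of_bits_less[OF k(2)] P by simp
  qed
  moreover have "degree (?p u - ?p w) < degree P"
    using u w P by (intro degree_diff_less degree_poly_of_bits_less) auto
  ultimately have "?p u - ?p w = 0" by (metis dvd_imp_degree_le linorder_not_less)
  then show "u = w" by (simp add: poly_of_bits_inject)
qed

text \<open>Multiplication by a nonzero \<open>k\<close> is an injective self-map of a finite set,
  hence a permutation.\<close>

lemma sum_gf_mult:
  fixes h :: "nat \<Rightarrow> 'a :: comm_monoid_add"
  assumes P: "irreducible P" "degree P > 0" and k: "0 < k" "k < 2 ^ degree P"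
  shows "(\<Sum>u<2 ^ degree P. h (gf_mult P u k)) = (\<Sum>w<2 ^ degree P. h w)"
proof -
  have inj: "inj_on (\<lambda>u. gf_mult P u k) {..<2 ^ degree P}"
    using assms by (rule inj_on_gf_mult)
  have "(\<lambda>u. gf_mult P u k) ` {..<2 ^ degree P} = {..<2 ^ degree P}"
    by (rule endo_inj_surj[OF _ _ inj]) (auto simp: gf_mult_less P)
  then show ?thesis
    using sum.reindex[OF inj, of h] by simp
qed

text \<open>Truncation to the low \<open>m\<close> bits takes every value equally often, so
  uniformity survives it.\<close>

lemma sum_mod_power2:
  fixes h :: "nat \<Rightarrow> real"
  assumes "m \<le> r"
  shows "(\<Sum>w<2 ^ r. h (w mod 2 ^ m)) = 2 ^ (r - m) * (\<Sum>w<2 ^ m. h w)"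
proof -
  have "(2 :: nat) ^ r = 2 ^ (r - m) * 2 ^ m" using assms by (simp flip: power_add)
  then have "(\<Sum>w<2 ^ r. h (w mod 2 ^ m)) = (\<Sum>w<2 ^ (r - m) * 2 ^ m. (\<lambda>i j. h j) (w div 2 ^ m) (w mod 2 ^ m))"
    by simp
  also have "\<dots> = (\<Sum>i<(2::nat) ^ (r - m). \<Sum>w<2 ^ m. h w)" by (rule sum_div_mod)
  finally show ?thesis by simp
qed

lemma mult_power2_add_less:
  fixes k w :: nat
  assumes "k < 2 ^ l" "w < 2 ^ m"
  shows "k * 2 ^ m + w < 2 ^ (l + m)"
  unfolding power_add using assms by (rule mult_add_less_mult)

lemma xor_mult_power2_add:
  fixes a b c d :: nat
  assumes "b < 2 ^ m" "d < 2 ^ m"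
  shows "xor (a * 2 ^ m + b) (c * 2 ^ m + d) = xor a c * 2 ^ m + xor b d"
proof -
  let ?x = "xor (a * 2 ^ m + b) (c * 2 ^ m + d)"
  have "?x div 2 ^ m = xor a c"
    using assms by (simp flip: drop_bit_eq_div) (simp add: drop_bit_eq_div)
  moreover have "?x mod 2 ^ m = xor b d"
    using assms by (simp flip: take_bit_eq_mod) (simp add: take_bit_eq_mod)
  ultimately show ?thesis by (metis div_mult_mod_eq)
qed

text \<open>The mask \<open>v\<close> cancels and the field product is additive in the key, so only
  the difference \<open>xor j k\<close> remains.\<close>

lemma b_fun_xor:
  assumes "v < 2 ^ (2 * n - l)"
  shows "xor (b_fun P n l j u v) (b_fun P n l k u v) =
    xor j k * 2 ^ (2 * n - l) + gf_mult P u (xor j k) mod 2 ^ (2 * n - l)"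
proof -
  let ?m = "2 * n - l"
  have x: "xor (xor a v) (xor b v) = xor a b" for a b :: nat
    by (rule bit_eqI) (auto simp: bit_xor_iff)
  have "xor (gf_mult P u j mod 2 ^ ?m) (gf_mult P u k mod 2 ^ ?m) = gf_mult P u (xor j k) mod 2 ^ ?m"
    by (simp add: gf_mult_xor flip: take_bit_eq_mod)
  then show ?thesis
    unfolding b_fun_def using assms
    by (subst xor_mult_power2_add) (auto simp: xor_nat_less_power2 x)
qed

lemma b_fun_less:
  assumes "k < 2 ^ l" "v < 2 ^ (2 * n - l)" "l \<le> 2 * n"
  shows "b_fun P n l k u v < 2 ^ (2 * n)"
proof -
  have "b_fun P n l k u v < 2 ^ (l + (2 * n - l))"
    unfolding b_fun_def using assms by (intro mult_power2_add_less xor_nat_less_power2) auto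
  then show ?thesis using assms by simp
qed

text \<open>For \<open>k \<noteq> 0\<close> the product \<open>uk\<close> is uniform in \<open>u\<close>, so averaging over \<open>u\<close> turns the sum over
  the pairs of keys into a sum over all \<open>\<beta>\<close> whose first \<open>l\<close> bits do not all vanish.\<close>

lemma sum_b_fun_xor_le:
  fixes t :: "nat \<Rightarrow> real"
  assumes P: "irreducible P" "degree P = max l (2 * n - l)" "degree P > 0"
    and l: "l \<le> 2 * n" and v: "v < 2 ^ (2 * n - l)"
    and t: "\<And>\<beta>. \<beta> < 2 ^ (2 * n) \<Longrightarrow> 0 \<le> t \<beta>"
  shows "(\<Sum>u<2 ^ degree P. \<Sum>j<2 ^ l. \<Sum>k<2 ^ l. t (xor (b_fun P n l j u v) (b_fun P n l k u v)))
    \<le> 2 ^ degree P * (2 ^ l * t 0 + 2 ^ (2 * l) / 2 ^ (2 * n) * (\<Sum>\<beta><2 ^ (2 * n). t \<beta>))"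
proof -
  let ?m = "2 * n - l" and ?r = "degree P"
  let ?g = "\<lambda>u c. t (c * 2 ^ ?m + gf_mult P u c mod 2 ^ ?m)"
  let ?T = "\<lambda>c. \<Sum>w<2 ^ ?m. t (c * 2 ^ ?m + w)"
  have mr: "?m \<le> ?r" and lr: "l \<le> ?r" using P by auto
  have "(\<Sum>j<2 ^ l. \<Sum>k<2 ^ l. t (xor (b_fun P n l j u v) (b_fun P n l k u v))) =
      2 ^ l * (\<Sum>c<2 ^ l. ?g u c)" for u
  proof -
    \<comment> \<open>Reindexing by the key difference \<open>c\<close> makes the inner sum
      independent of \<open>j\<close>, whence the factor 2^l.\<close>
    have "(\<Sum>k<2 ^ l. ?g u (xor k j)) = (\<Sum>c<2 ^ l. ?g u c)" if "j < 2 ^ l" for j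
      using that by (rule sum_xor_shift)
    then have "(\<Sum>k<2 ^ l. t (xor (b_fun P n l j u v) (b_fun P n l k u v))) = (\<Sum>c<2 ^ l. ?g u c)"
      if "j < 2 ^ l" for j
      unfolding b_fun_xor[OF v] xor.commute[of j] using that by blast
    then show ?thesis by simp
  qed
  then have "(\<Sum>u<2 ^ ?r. \<Sum>j<2 ^ l. \<Sum>k<2 ^ l. t (xor (b_fun P n l j u v) (b_fun P n l k u v))) =
      2 ^ l * (\<Sum>u<2 ^ ?r. \<Sum>c<2 ^ l. ?g u c)"
    by (simp only: sum_distrib_left)
  also have "(\<Sum>u<2 ^ ?r. \<Sum>c<2 ^ l. ?g u c) = (\<Sum>c<2 ^ l. \<Sum>u<2 ^ ?r. ?g u c)"
    by (rule sum.swap)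
  also have "2 ^ l * (\<Sum>c<2 ^ l. \<Sum>u<2 ^ ?r. ?g u c) \<le> 2 ^ l * (2 ^ ?r * t 0 + 2 ^ (?r - ?m) * (\<Sum>\<beta><2 ^ (2 * n). t \<beta>))"
  proof (rule mult_left_mono)
    have "(\<Sum>u<2 ^ ?r. ?g u c) \<le> (if c = 0 then 2 ^ ?r * t 0 else 0) + 2 ^ (?r - ?m) * ?T c"
      if c: "c < 2 ^ l" for c
    proof (cases "c = 0")
      case True
      \<comment> \<open>For \<open>c = 0\<close> the product \<open>uk\<close> is constantly 0 and
        only \<open>t 0\<close> arises. Adding the nonnegative \<open>?T 0\<close> completes the
        range to all \<beta>; this is where equality is given up.\<close>
      have "0 \<le> ?T 0"
        using l by (intro sum_nonneg t) (auto intro: order.strict_trans2)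
      then show ?thesis using True by (simp add: gf_mult_zero)
    next
      case False
      have "c < 2 ^ ?r" using c lr by (meson order.strict_trans2 power_increasing one_le_numeral)
      then have "(\<Sum>u<2 ^ ?r. ?g u c) = (\<Sum>w<2 ^ ?r. t (c * 2 ^ ?m + w mod 2 ^ ?m))"
        using False P by (intro sum_gf_mult[where h = "\<lambda>w. t (c * 2 ^ ?m + w mod 2 ^ ?m)"]) auto
      also have "\<dots> = 2 ^ (?r - ?m) * ?T c"
        by (rule sum_mod_power2[OF mr, where h = "\<lambda>w. t (c * 2 ^ ?m + w)"])
      finally show ?thesis using False by simp
    qed
    then have "(\<Sum>c<2 ^ l. \<Sum>u<2 ^ ?r. ?g u c) \<le>
        (\<Sum>c<2 ^ l. (if c = 0 then 2 ^ ?r * t 0 else 0) + 2 ^ (?r - ?m) * ?T c)"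
      by (intro sum_mono) auto
    also have "\<dots> = 2 ^ ?r * t 0 + 2 ^ (?r - ?m) * (\<Sum>c<2 ^ l. ?T c)"
      by (simp add: sum.distrib sum_distrib_left)
    also have "(\<Sum>c<2 ^ l. ?T c) = (\<Sum>\<beta><2 ^ l * 2 ^ ?m. (\<lambda>c w. t (c * 2 ^ ?m + w)) (\<beta> div 2 ^ ?m) (\<beta> mod 2 ^ ?m))"
      by (rule sum_div_mod[symmetric])
    also have "(2 :: nat) ^ l * 2 ^ ?m = 2 ^ (2 * n)"
      using l by (simp flip: power_add)
    finally show "(\<Sum>c<2 ^ l. \<Sum>u<2 ^ ?r. ?g u c) \<le> 2 ^ ?r * t 0 + 2 ^ (?r - ?m) * (\<Sum>\<beta><2 ^ (2 * n). t \<beta>)"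
      by (simp only: div_mult_mod_eq)
  qed simp
  also have "\<dots> = 2 ^ ?r * (2 ^ l * t 0 + 2 ^ (2 * l) / 2 ^ (2 * n) * (\<Sum>\<beta><2 ^ (2 * n). t \<beta>))"
  proof -
    \<comment> \<open>These identities give 2^l 2^(r-m) = 2^r 2^(2l) / 2^(2n).\<close>
    have "2 ^ (2 * n) = (2 :: real) ^ l * 2 ^ ?m" using l by (simp flip: power_add)
    moreover have "(2 :: real) ^ ?r = 2 ^ (?r - ?m) * 2 ^ ?m" using mr by (simp flip: power_add)
    moreover have "(2 :: real) ^ (2 * l) = 2 ^ l * 2 ^ l" by (simp add: mult_2 power_add)
    ultimately show ?thesis by (simp only:) (simp add: field_simps)
  qed
  finally show ?thesis .
qed

section \<open>Second moment of the deviation\<close>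

lemma pauli_kron_one_carrier:
  "kron (pauli_op n \<beta>) (1\<^sub>m d) \<in> carrier_mat (2 ^ n * d) (2 ^ n * d)"
  by (rule carrier_matI) auto

lemma tr_F_op:
  assumes "\<beta> < 2 ^ (2 * n)" "X \<in> carrier_mat (2 ^ n * d) (2 ^ n * d)"
  shows "tr (F_op n d \<beta> X) = tr X"
  unfolding F_op_def using assms
  by (subst tr_mult_commute)
     (auto simp: unitary_cancel[OF unitary_pauli_kron_one pauli_kron_one_carrier])

lemma F_op_mult:
  assumes "\<beta> < 2 ^ (2 * n)" "X \<in> carrier_mat (2 ^ n * d) (2 ^ n * d)" "Y \<in> carrier_mat (2 ^ n * d) (2 ^ n * d)"
  shows "F_op n d \<beta> X * F_op n d \<beta> Y = F_op n d \<beta> (X * Y)"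
  using assms carrier_matD[OF assms(2)] carrier_matD[OF assms(3)] unfolding F_op_def
  by (simp add: mult_mat_assoc unitary_cancel[OF unitary_pauli_kron_one pauli_kron_one_carrier])

lemma adj_F_op:
  assumes "X \<in> carrier_mat (2 ^ n * d) (2 ^ n * d)"
  shows "adj (F_op n d \<beta> X) = F_op n d \<beta> (adj X)"
  using carrier_matD[OF assms] unfolding F_op_def by (simp add: adj_mult mult_mat_assoc)

lemma F_op_0:
  assumes "X \<in> carrier_mat (2 ^ n * d) (2 ^ n * d)"
  shows "F_op n d 0 X = X"
  using assms by (intro eq_matI) (auto simp: index_F_op bit_char_def)

text \<open>Since F_\<gamma> = F_\<beta> F_(\<beta>+\<gamma>), the common conjugation F_\<beta> can
  be pulled out and preserves the trace.\<close>

lemma tr_F_op_mult_F_op: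
  assumes "\<beta> < 2 ^ (2 * n)" "\<gamma> < 2 ^ (2 * n)" "X \<in> carrier_mat (2 ^ n * d) (2 ^ n * d)"
  shows "tr (F_op n d \<beta> X * F_op n d \<gamma> X) = tr (X * F_op n d (xor \<beta> \<gamma>) X)"
proof -
  have "F_op n d \<gamma> X = F_op n d \<beta> (F_op n d (xor \<beta> \<gamma>) X)"
    using assms by (simp add: F_op_F_op xor_nat_less_power2 flip: xor.assoc)
  then show ?thesis
    using assms by (simp add: F_op_mult tr_F_op mult_carrier_mat)
qed

text \<open>With F_\<beta>(X) = \<open>M * adj M\<close>, cyclicity turns the trace into the squared
  Hilbert-Schmidt norm of \<open>adj M * L\<close>.\<close>

lemma tr_mult_F_op_nonneg:
  assumes "L \<in> carrier_mat (2 ^ n * d) (2 ^ n * d)" and X: "X = L * adj L"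
  shows "0 \<le> Re (tr (X * F_op n d \<beta> X))"
proof -
  define M where "M = kron (pauli_op n \<beta>) (1\<^sub>m d) * L"
  note [simp] = carrier_matD[OF assms(1)]
  have M[simp]: "dim_row M = 2 ^ n * d" "dim_col M = 2 ^ n * d" by (auto simp: M_def)
  have "F_op n d \<beta> X = M * adj M"
    unfolding F_op_def X M_def by (simp add: adj_mult mult_mat_assoc)
  then have "tr (X * F_op n d \<beta> X) = tr (L * (adj L * (M * adj M)))"
    by (simp add: X mult_mat_assoc)
  also have "\<dots> = tr (adj (adj M * L) * (adj M * L))"
    by (subst tr_mult_commute) (simp_all add: adj_mult mult_mat_assoc)
  finally show ?thesis using Re_tr_adj_mult_self_nonneg by simp
qed

text \<open>The dimension is explicit, so an empty combination is the \<open>N\<close> by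
  \<open>N\<close> zero matrix.\<close>

definition lincomb :: "nat \<Rightarrow> 'i set \<Rightarrow> ('i \<Rightarrow> complex) \<Rightarrow> ('i \<Rightarrow> complex mat) \<Rightarrow> complex mat" where
  "lincomb N I w B = mat N N (\<lambda>ij. \<Sum>x\<in>I. w x * B x $$ ij)"

lemma dim_lincomb[simp]: "dim_row (lincomb N I w B) = N" "dim_col (lincomb N I w B) = N"
  by (simp_all add: lincomb_def)

lemma lincomb_carrier[simp]: "lincomb N I w B \<in> carrier_mat N N"
  by (simp add: lincomb_def)

lemma adj_lincomb:
  assumes "\<And>x. x \<in> I \<Longrightarrow> B x \<in> carrier_mat N N" "\<And>x. x \<in> I \<Longrightarrow> cnj (w x) = w x"
  shows "adj (lincomb N I w B) = lincomb N I w (\<lambda>x. adj (B x))"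
proof (rule eq_matI)
  fix i j assume "i < dim_row (lincomb N I w (\<lambda>x. adj (B x)))" "j < dim_col (lincomb N I w (\<lambda>x. adj (B x)))"
  then have ij: "i < N" "j < N" by auto
  have "adj (B x) $$ (i,j) = cnj (B x $$ (j,i))" if "x \<in> I" for x
    using assms(1)[OF that] ij by auto
  then show "adj (lincomb N I w B) $$ (i,j) = lincomb N I w (\<lambda>x. adj (B x)) $$ (i,j)"
    using ij assms(2) by (auto simp: lincomb_def intro!: sum.cong)
qed auto

lemma mult_lincomb:
  assumes "A \<in> carrier_mat N N" "\<And>x. x \<in> I \<Longrightarrow> B x \<in> carrier_mat N N"
  shows "A * lincomb N I w B = lincomb N I w (\<lambda>x. A * B x)"
proof (rule eq_matI)
  fix i j assume "i < dim_row (lincomb N I w (\<lambda>x. A * B x))" "j < dim_col (lincomb N I w (\<lambda>x. A * B x))"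
  then have ij: "i < N" "j < N" by auto
  have AB: "(A * B x) $$ (i,j) = (\<Sum>k<N. A $$ (i,k) * B x $$ (k,j))" if "x \<in> I" for x
    using assms(1) assms(2)[OF that] ij by (subst index_mult_mat_sum) auto
  have "(A * lincomb N I w B) $$ (i,j) = (\<Sum>k<N. \<Sum>x\<in>I. w x * (A $$ (i,k) * B x $$ (k,j)))"
    using assms(1) ij by (subst index_mult_mat_sum)
      (auto simp: lincomb_def sum_distrib_left mult_ac intro!: sum.cong)
  also have "\<dots> = (\<Sum>x\<in>I. w x * (A * B x) $$ (i,j))"
    by (subst sum.swap) (simp add: AB sum_distrib_left del: index_mult_mat(1))
  finally show "(A * lincomb N I w B) $$ (i,j) = lincomb N I w (\<lambda>x. A * B x) $$ (i,j)"
    using ij by (simp add: lincomb_def del: index_mult_mat(1))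
qed (use assms in auto)

lemma lincomb_mult:
  assumes "A \<in> carrier_mat N N" "\<And>x. x \<in> I \<Longrightarrow> B x \<in> carrier_mat N N"
  shows "lincomb N I w B * A = lincomb N I w (\<lambda>x. B x * A)"
proof (rule eq_matI)
  fix i j assume "i < dim_row (lincomb N I w (\<lambda>x. B x * A))" "j < dim_col (lincomb N I w (\<lambda>x. B x * A))"
  then have ij: "i < N" "j < N" by auto
  have BA: "(B x * A) $$ (i,j) = (\<Sum>k<N. B x $$ (i,k) * A $$ (k,j))" if "x \<in> I" for x
    using assms(1) assms(2)[OF that] ij by (subst index_mult_mat_sum) auto
  have "(lincomb N I w B * A) $$ (i,j) = (\<Sum>k<N. \<Sum>x\<in>I. w x * (B x $$ (i,k) * A $$ (k,j)))"
    using assms(1) ij by (subst index_mult_mat_sum)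
      (auto simp: lincomb_def sum_distrib_left mult_ac intro!: sum.cong)
  also have "\<dots> = (\<Sum>x\<in>I. w x * (B x * A) $$ (i,j))"
    by (subst sum.swap) (simp add: BA sum_distrib_left del: index_mult_mat(1))
  finally show "(lincomb N I w B * A) $$ (i,j) = lincomb N I w (\<lambda>x. B x * A) $$ (i,j)"
    using ij by (simp add: lincomb_def del: index_mult_mat(1))
qed (use assms in auto)

lemma tr_lincomb:
  assumes "\<And>x. x \<in> I \<Longrightarrow> B x \<in> carrier_mat N N"
  shows "tr (lincomb N I w B) = (\<Sum>x\<in>I. w x * tr (B x))"
proof -
  have "tr (lincomb N I w B) = (\<Sum>x\<in>I. \<Sum>i<N. w x * B x $$ (i,i))"
    unfolding tr_def by (subst sum.swap) (simp add: lincomb_def)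
  also have "\<dots> = (\<Sum>x\<in>I. w x * tr (B x))"
    using assms by (intro sum.cong) (auto simp: tr_def sum_distrib_left)
  finally show ?thesis .
qed

lemma tr_lincomb_square:
  assumes B: "\<And>x. x \<in> I \<Longrightarrow> B x \<in> carrier_mat N N"
  shows "tr (lincomb N I w B * lincomb N I w B) = (\<Sum>x\<in>I. \<Sum>y\<in>I. w x * w y * tr (B x * B y))"
proof -
  have "tr (lincomb N I w B * lincomb N I w B) = (\<Sum>x\<in>I. w x * tr (B x * lincomb N I w B))"
    using B by (subst lincomb_mult) (auto intro!: tr_lincomb mult_carrier_mat[of _ N N])
  also have "\<dots> = (\<Sum>x\<in>I. w x * (\<Sum>y\<in>I. w y * tr (B x * B y)))"
  proof (intro sum.cong refl arg_cong2[where f = "(*)"])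
    fix x assume x: "x \<in> I"
    show "tr (B x * lincomb N I w B) = (\<Sum>y\<in>I. w y * tr (B x * B y))"
      using B B[OF x] by (subst mult_lincomb) (auto intro!: tr_lincomb mult_carrier_mat[of _ N N])
  qed
  finally show ?thesis by (simp add: sum_distrib_left mult_ac)
qed

text \<open>The deviation \<open>R\<^sub>u\<^sub>v(X) - \<tau> \<otimes> X\<^sup>E\<close> is a real combination of the \<open>F\<^sub>\<beta>(X)\<close>: the left summand
  indexes the keys of \<open>R\<^sub>u\<^sub>v\<close>, the right one the full Pauli twirl.\<close>

definition dev_index :: "nat \<Rightarrow> nat \<Rightarrow> (nat + nat) set" where
  "dev_index n l = {..<2 ^ l} <+> {..<2 ^ (2 * n)}"

definition dev_weight :: "nat \<Rightarrow> nat \<Rightarrow> nat + nat \<Rightarrow> real" where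
  "dev_weight n l = case_sum (\<lambda>_. 1 / 2 ^ l) (\<lambda>_. - 1 / 2 ^ (2 * n))"

definition dev_key :: "bit poly \<Rightarrow> nat \<Rightarrow> nat \<Rightarrow> nat \<Rightarrow> nat \<Rightarrow> nat + nat \<Rightarrow> nat" where
  "dev_key P n l u v = case_sum (\<lambda>k. b_fun P n l k u v) (\<lambda>\<beta>. \<beta>)"

definition deviation :: "bit poly \<Rightarrow> nat \<Rightarrow> nat \<Rightarrow> nat \<Rightarrow> nat \<Rightarrow> nat \<Rightarrow> complex mat \<Rightarrow> complex mat" where
  "deviation P n l d u v X = lincomb (2 ^ n * d) (dev_index n l) (\<lambda>x. complex_of_real (dev_weight n l x))
     (\<lambda>x. F_op n d (dev_key P n l u v x) X)"

lemma deviation_carrier[simp]: "deviation P n l d u v X \<in> carrier_mat (2 ^ n * d) (2 ^ n * d)"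
  by (simp add: deviation_def)

lemma dev_key_less:
  assumes "l \<le> 2 * n" "v < 2 ^ (2 * n - l)" "x \<in> dev_index n l"
  shows "dev_key P n l u v x < 2 ^ (2 * n)"
  using assms b_fun_less by (auto simp: dev_key_def dev_index_def)

lemma sum_dev_index:
  "(\<Sum>x\<in>dev_index n l. f x) = (\<Sum>k<2 ^ l. f (Inl k)) + (\<Sum>\<beta><2 ^ (2 * n). f (Inr \<beta>))"
  unfolding dev_index_def by (subst sum.Plus) auto

text \<open>The full twirl rewrites the ideal state as the average of all F_\<beta>(X).\<close>

lemma R_op_minus_eq_deviation:
  assumes X: "X \<in> carrier_mat (2 ^ n * d) (2 ^ n * d)"
  shows "R_op P n l d u v X - kron (maxmixed (2 ^ n)) (ptrace_A (2 ^ n) d X) = deviation P n l d u v X"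
    (is "_ - ?T = _")
proof (rule eq_matI)
  have T: "dim_row ?T = 2 ^ n * d" "dim_col ?T = 2 ^ n * d" by (auto simp: maxmixed_def ptrace_A_def)
  show "dim_row (R_op P n l d u v X - ?T) = dim_row (deviation P n l d u v X)"
    "dim_col (R_op P n l d u v X - ?T) = dim_col (deviation P n l d u v X)"
    using T by (simp_all add: deviation_def)
  fix i j assume "i < dim_row (deviation P n l d u v X)" "j < dim_col (deviation P n l d u v X)"
  then have ij: "i < 2 ^ n * d" "j < 2 ^ n * d" by (auto simp: deviation_def)
  have "deviation P n l d u v X $$ (i,j) = 1 / 2 ^ l * (\<Sum>k<2 ^ l. F_op n d (b_fun P n l k u v) X $$ (i,j))
      - 1 / 2 ^ (2 * n) * (\<Sum>\<beta><2 ^ (2 * n). F_op n d \<beta> X $$ (i,j))"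
    using ij by (simp add: deviation_def lincomb_def sum_dev_index dev_weight_def dev_key_def
        sum_distrib_left sum_negf)
  also have "(\<Sum>\<beta><2 ^ (2 * n). F_op n d \<beta> X $$ (i,j)) = 2 ^ (2 * n) * ?T $$ (i,j)"
    by (rule F_op_twirl[OF X ij])
  finally show "(R_op P n l d u v X - ?T) $$ (i,j) = deviation P n l d u v X $$ (i,j)"
    using ij T X by (simp add: R_op_def)
qed

lemma adj_deviation:
  assumes X: "X \<in> carrier_mat (2 ^ n * d) (2 ^ n * d)" "adj X = X"
  shows "adj (deviation P n l d u v X) = deviation P n l d u v X"
  unfolding deviation_def by (subst adj_lincomb) (auto simp: adj_F_op X)

text \<open>\<open>Q\<close> commutes with every Pauli operator on A, so it can be pulled out of
  each F_\<beta> and hence out of the combination.\<close>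

lemma deviation_conj:
  assumes X: "X \<in> carrier_mat (2 ^ n * d) (2 ^ n * d)"
    and Q: "Q \<in> carrier_mat (2 ^ n * d) (2 ^ n * d)" "adj Q = Q"
    and comm: "\<And>\<beta>. kron (pauli_op n \<beta>) (1\<^sub>m d) * Q = Q * kron (pauli_op n \<beta>) (1\<^sub>m d)"
  shows "deviation P n l d u v (Q * X * Q) = Q * deviation P n l d u v X * Q"
proof -
  note [simp] = carrier_matD[OF X] carrier_matD[OF Q(1)]
  have F: "F_op n d \<beta> (Q * X * Q) = Q * F_op n d \<beta> X * Q" for \<beta>
  proof -
    let ?K = "kron (pauli_op n \<beta>) (1\<^sub>m d)"
    \<comment> \<open>Taking adjoints, with \<open>Q\<close> Hermitian, yields commutation with
      \<open>adj ?K\<close> as well.\<close>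
    have "adj (Q * ?K) = adj (?K * Q)" by (simp only: comm)
    then have adj: "adj ?K * Q = Q * adj ?K" by (simp add: adj_mult Q)
    have "F_op n d \<beta> (Q * X * Q) = (?K * Q) * X * (Q * adj ?K)"
      unfolding F_op_def by (simp add: mult_mat_assoc)
    also have "\<dots> = Q * F_op n d \<beta> X * Q"
      unfolding comm F_op_def adj[symmetric] by (simp add: mult_mat_assoc)
    finally show ?thesis .
  qed
  show ?thesis
    unfolding deviation_def F using Q by (subst mult_lincomb, simp, simp) (subst lincomb_mult, auto)
qed

text \<open>The square has a key-key part, two mixed parts and a twirl-twirl part. XOR with a fixed
  string permutes all \<beta>, so each mixed part and the last one collapse to the same mean of
  \<open>t\<close>; with signs -1, -1, +1 one negative copy remains.\<close>

lemma tr_deviation_square: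
  assumes X: "X \<in> carrier_mat (2 ^ n * d) (2 ^ n * d)" and l: "l \<le> 2 * n" and v: "v < 2 ^ (2 * n - l)"
  defines "t \<equiv> \<lambda>\<beta>. Re (tr (X * F_op n d \<beta> X))"
  shows "Re (tr (deviation P n l d u v X * deviation P n l d u v X)) =
    (\<Sum>j<2 ^ l. \<Sum>k<2 ^ l. t (xor (b_fun P n l j u v) (b_fun P n l k u v))) / 2 ^ (2 * l)
      - (\<Sum>\<beta><2 ^ (2 * n). t \<beta>) / 2 ^ (2 * n)"
proof -
  let ?I = "dev_index n l" and ?w = "dev_weight n l" and ?b = "dev_key P n l u v"
  let ?T = "\<Sum>\<beta><2 ^ (2 * n). t \<beta>"
  have pow: "(2 :: real) ^ (2 * l) = 2 ^ l * 2 ^ l" by (simp add: mult_2 power_add)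
  have "tr (deviation P n l d u v X * deviation P n l d u v X) =
      (\<Sum>x\<in>?I. \<Sum>y\<in>?I. complex_of_real (?w x) * complex_of_real (?w y) * tr (F_op n d (?b x) X * F_op n d (?b y) X))"
    unfolding deviation_def by (rule tr_lincomb_square) simp
  also have "\<dots> = (\<Sum>x\<in>?I. \<Sum>y\<in>?I. complex_of_real (?w x * ?w y) * tr (X * F_op n d (xor (?b x) (?b y)) X))"
    using X dev_key_less[OF l v] by (intro sum.cong refl) (simp add: tr_F_op_mult_F_op)
  finally have "Re (tr (deviation P n l d u v X * deviation P n l d u v X)) =
      (\<Sum>x\<in>?I. \<Sum>y\<in>?I. ?w x * ?w y * t (xor (?b x) (?b y)))"
    unfolding t_def by simp
  also have "\<dots> = (\<Sum>j<2 ^ l. \<Sum>k<2 ^ l. t (xor (b_fun P n l j u v) (b_fun P n l k u v)) / 2 ^ (2 * l))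
      - (\<Sum>k<2 ^ l. \<Sum>\<beta><2 ^ (2 * n). t (xor (b_fun P n l k u v) \<beta>) / (2 ^ l * 2 ^ (2 * n)))
      - (\<Sum>\<beta><2 ^ (2 * n). \<Sum>k<2 ^ l. t (xor \<beta> (b_fun P n l k u v)) / (2 ^ l * 2 ^ (2 * n)))
      + (\<Sum>\<beta><2 ^ (2 * n). \<Sum>\<gamma><2 ^ (2 * n). t (xor \<beta> \<gamma>) / (2 ^ (2 * n) * 2 ^ (2 * n)))"
    by (simp add: sum_dev_index dev_weight_def dev_key_def sum.distrib sum_negf sum_subtractf pow
        mult.commute[of "2 ^ (2 * n)" "2 ^ l"])
  also have "(\<Sum>\<beta><2 ^ (2 * n). \<Sum>k<2 ^ l. t (xor \<beta> (b_fun P n l k u v)) / (2 ^ l * 2 ^ (2 * n))) =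
      (\<Sum>k<2 ^ l. \<Sum>\<beta><2 ^ (2 * n). t (xor (b_fun P n l k u v) \<beta>) / (2 ^ l * 2 ^ (2 * n)))"
    by (subst sum.swap) (simp add: xor.commute)
  also have "\<dots> = (\<Sum>k<(2::nat) ^ l. ?T / (2 ^ l * 2 ^ (2 * n)))"
  proof (intro sum.cong refl)
    fix k :: nat assume k: "k \<in> {..<2 ^ l}"
    then have "(\<Sum>\<beta><2 ^ (2 * n). t (xor \<beta> (b_fun P n l k u v))) = ?T"
      using l v by (intro sum_xor_shift b_fun_less) auto
    then show "(\<Sum>\<beta><2 ^ (2 * n). t (xor (b_fun P n l k u v) \<beta>) / (2 ^ l * 2 ^ (2 * n))) = ?T / (2 ^ l * 2 ^ (2 * n))"
      by (simp add: xor.commute flip: sum_divide_distrib)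
  qed
  also have "\<dots> = ?T / 2 ^ (2 * n)" by simp
  also have "(\<Sum>\<beta><2 ^ (2 * n). \<Sum>\<gamma><2 ^ (2 * n). t (xor \<beta> \<gamma>) / (2 ^ (2 * n) * 2 ^ (2 * n))) =
      (\<Sum>\<beta><(2::nat) ^ (2 * n). ?T / (2 ^ (2 * n) * 2 ^ (2 * n)))"
  proof (intro sum.cong refl)
    fix \<beta> :: nat assume "\<beta> \<in> {..<2 ^ (2 * n)}"
    then have "(\<Sum>\<gamma><2 ^ (2 * n). t (xor \<gamma> \<beta>)) = ?T" by (intro sum_xor_shift) auto
    then show "(\<Sum>\<gamma><2 ^ (2 * n). t (xor \<beta> \<gamma>) / (2 ^ (2 * n) * 2 ^ (2 * n))) = ?T / (2 ^ (2 * n) * 2 ^ (2 * n))"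
      by (simp add: xor.commute flip: sum_divide_distrib)
  qed
  also have "\<dots> = ?T / 2 ^ (2 * n)" by simp
  finally show ?thesis by (simp add: sum_divide_distrib)
qed

text \<open>The mean of \<open>t\<close> over all \<beta> in the bound for the key pairs cancels
  against the subtracted mean, leaving only the collision term \<open>t 0\<close> = Tr X^2.\<close>

lemma sum_tr_deviation_square_le:
  assumes X: "X \<in> carrier_mat (2 ^ n * d) (2 ^ n * d)" "L \<in> carrier_mat (2 ^ n * d) (2 ^ n * d)" "X = L * adj L"
    and P: "irreducible P" "degree P = max l (2 * n - l)" "degree P > 0"
    and l: "l \<le> 2 * n" and v: "v < 2 ^ (2 * n - l)"
  shows "(\<Sum>u<2 ^ degree P. Re (tr (deviation P n l d u v X * deviation P n l d u v X)))
    \<le> 2 ^ degree P / 2 ^ l * Re (tr (X * X))"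
proof -
  define t where "t = (\<lambda>\<beta>. Re (tr (X * F_op n d \<beta> X)))"
  let ?T = "\<Sum>\<beta><2 ^ (2 * n). t \<beta>" and ?r = "degree P"
  have t0: "t 0 = Re (tr (X * X))" using F_op_0[OF X(1)] by (simp add: t_def)
  have "Re (tr (deviation P n l d u v X * deviation P n l d u v X)) =
      (\<Sum>j<2 ^ l. \<Sum>k<2 ^ l. t (xor (b_fun P n l j u v) (b_fun P n l k u v))) / 2 ^ (2 * l) - ?T / 2 ^ (2 * n)" for u
    unfolding t_def by (rule tr_deviation_square[OF X(1) l v])
  then have "(\<Sum>u<2 ^ ?r. Re (tr (deviation P n l d u v X * deviation P n l d u v X))) =
      (\<Sum>u<2 ^ ?r. \<Sum>j<2 ^ l. \<Sum>k<2 ^ l. t (xor (b_fun P n l j u v) (b_fun P n l k u v))) / 2 ^ (2 * l)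
        - 2 ^ ?r * (?T / 2 ^ (2 * n))"
    by (simp add: sum_subtractf sum_divide_distrib)
  also have "\<dots> \<le> 2 ^ ?r * (2 ^ l * t 0 + 2 ^ (2 * l) / 2 ^ (2 * n) * ?T) / 2 ^ (2 * l) - 2 ^ ?r * (?T / 2 ^ (2 * n))"
    using X by (intro diff_right_mono divide_right_mono sum_b_fun_xor_le[OF P l v])
      (auto simp: t_def intro: tr_mult_F_op_nonneg)
  also have "\<dots> = 2 ^ ?r / 2 ^ l * t 0"
  proof -
    have "(2 :: real) ^ (2 * l) = 2 ^ l * 2 ^ l" by (simp add: mult_2 power_add)
    then show ?thesis by (simp only:) (simp add: field_simps)
  qed
  finally show ?thesis by (simp add: t0)
qed

section \<open>The conditional collision entropy bound\<close>

lemma herm_diag_add: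
  assumes "U \<in> carrier_mat k k"
  shows "herm_diag U k d + herm_diag U k e = herm_diag U k (\<lambda>i. d i + e i)"
  using assms by (intro eq_matI) (auto simp: index_herm_diag algebra_simps sum.distrib)

lemma herm_diag_zero:
  assumes "U \<in> carrier_mat k k"
  shows "herm_diag U k (\<lambda>i. 0) = 0\<^sub>m k k"
  using assms by (intro eq_matI) (auto simp: index_herm_diag)

text \<open>The columns of the kernel projection \<open>?E\<close> lie in the kernel of the spectral
  matrix, so \<rho> annihilates them; the two projections add up to the identity.\<close>

lemma mult_support_projection:
  assumes U: "unitary U" "U \<in> carrier_mat k k" and \<rho>: "\<rho> \<in> carrier_mat k k"
    and ker: "\<And>v. dim_vec v = k \<Longrightarrow> herm_diag U k g *\<^sub>v v = 0\<^sub>v k \<Longrightarrow> \<rho> *\<^sub>v v = 0\<^sub>v k"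
  shows "\<rho> * herm_diag U k (\<lambda>i. if g i = 0 then 0 else 1) = \<rho>"
proof -
  let ?E = "herm_diag U k (\<lambda>i. if g i = 0 then 1 else 0)"
  let ?S = "herm_diag U k (\<lambda>i. if g i = 0 then 0 else 1)"
  have "herm_diag U k g * ?E = herm_diag U k (\<lambda>i. 0)"
    unfolding herm_diag_mult[OF U] by (intro herm_diag_cong) auto
  then have GE: "herm_diag U k g * ?E = 0\<^sub>m k k" using herm_diag_zero U by simp
  have "\<rho> * ?E = 0\<^sub>m k k"
  proof (rule eq_matI)
    fix i j assume "i < dim_row (0\<^sub>m k k :: complex mat)" "j < dim_col (0\<^sub>m k k :: complex mat)"
    then have ij: "i < k" "j < k" by auto
    have "herm_diag U k g *\<^sub>v col ?E j = col (herm_diag U k g * ?E) j"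
      using U ij by (subst col_mult2[of _ k k _ k]) auto
    also have "\<dots> = 0\<^sub>v k" unfolding GE using ij by simp
    finally have "\<rho> *\<^sub>v col ?E j = 0\<^sub>v k" using ker U by simp
    moreover have "\<rho> *\<^sub>v col ?E j = col (\<rho> * ?E) j"
      using U \<rho> ij by (subst col_mult2[of _ k k _ k]) auto
    ultimately have "col (\<rho> * ?E) j $ i = 0" using ij by simp
    then show "(\<rho> * ?E) $$ (i,j) = 0\<^sub>m k k $$ (i,j)" using ij U \<rho> by simp
  qed (use U \<rho> in auto)
  moreover have "\<rho> * ?S + \<rho> * ?E = \<rho>"
  proof -
    have "?S + ?E = herm_diag U k (\<lambda>i. 1)"
      using U by (simp add: herm_diag_add) (intro herm_diag_cong, auto)
    then have "\<rho> * (?S + ?E) = \<rho>" using U \<rho> by (simp add: herm_diag_one)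
    then show ?thesis using U \<rho> by (subst mult_add_distrib_mat[symmetric, of _ k k _ k]) auto
  qed
  ultimately show ?thesis using U \<rho> by (simp add: right_add_zero_mat[of _ k k] mult_carrier_mat[of _ k k])
qed

text \<open>With \<open>S = (\<one> \<otimes> \<sigma>)\<^bsup>-1/4\<^esup>\<close> and \<open>Q = (\<one> \<otimes> \<sigma>)\<^bsup>1/4\<^esup>\<close>, the kernel condition makes \<open>SQ\<close> act as the
  identity on \<open>\<phi>\<close>.\<close>

lemma fourth_roots:
  assumes \<sigma>: "density d \<sigma>" and \<phi>: "\<phi> \<in> carrier_mat (m * d) (m * d)" "adj \<phi> = \<phi>"
    and ker: "\<And>v. dim_vec v = m * d \<Longrightarrow> kron (1\<^sub>m m) \<sigma> *\<^sub>v v = 0\<^sub>v (m * d) \<Longrightarrow> \<phi> *\<^sub>v v = 0\<^sub>v (m * d)"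
  defines "S \<equiv> mpow_m14 (kron (1\<^sub>m m) \<sigma>)"
  obtains Q where "S \<in> carrier_mat (m * d) (m * d)" "adj S = S"
    "Q \<in> carrier_mat (m * d) (m * d)" "adj Q = Q"
    "\<And>W. W \<in> carrier_mat m m \<Longrightarrow> kron W (1\<^sub>m d) * Q = Q * kron W (1\<^sub>m d)"
    "tr (Q * Q * (Q * Q)) = of_nat m" "\<phi> = Q * (S * \<phi> * S) * Q"
proof -
  let ?N = "m * d"
  have \<sigma>': "\<sigma> \<in> carrier_mat d d" "adj \<sigma> = \<sigma>" "psd \<sigma>" "tr \<sigma> = 1"
    using \<sigma> by (auto simp: density_def psd_def hermitian_def)
  obtain U e where U: "unitary U" "U \<in> carrier_mat d d" and e: "\<sigma> = herm_diag U d e"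
    using spectral_theorem[OF \<sigma>'(1,2)] by blast
  define Y where "Y = kron (1\<^sub>m m) U"
  define g where "g i = e (i mod d)" for i
  have Y: "unitary Y" "Y \<in> carrier_mat ?N ?N"
    using U by (auto simp: Y_def unitary_kron_one kron_carrier)
  have G: "kron (1\<^sub>m m) \<sigma> = herm_diag Y ?N g"
    unfolding e Y_def g_def using U by (simp add: kron_one_herm_diag)
  have g: "g i \<ge> 0" if "i < ?N" for i
    unfolding g_def using div_mod_less_mult[OF that] \<sigma>' U e by (auto intro: psd_herm_diag_nonneg)
  define Q where "Q = herm_diag Y ?N (\<lambda>i. g i powr (1/4))"
  define Pr where "Pr = herm_diag Y ?N (\<lambda>i. if g i = 0 then 0 else 1)"
  have S: "S = herm_diag Y ?N (\<lambda>i. if g i > 0 then g i powr (-1/4) else 0)"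
    unfolding S_def mpow_m14_def G by (rule matfun_herm_diag[OF Y])
  have carr: "S \<in> carrier_mat ?N ?N" "adj S = S" "Q \<in> carrier_mat ?N ?N" "adj Q = Q"
    using Y by (auto simp: S Q_def)
  have comm: "kron W (1\<^sub>m d) * Q = Q * kron W (1\<^sub>m d)" if W: "W \<in> carrier_mat m m" for W
  proof -
    have "kron W (1\<^sub>m d) * herm_diag Y ?N g = herm_diag Y ?N g * kron W (1\<^sub>m d)"
      unfolding G[symmetric] using W \<sigma>' by (simp add: kron_mult)
    \<comment> \<open>Commuting with the spectral matrix implies commuting with its fourth root: the
      intertwining lemma with both eigenbases equal.\<close>
    from herm_diag_intertwine[OF Y Y kron_carrier[OF W one_carrier_mat] this, of "\<lambda>x. x powr (1/4)"]
    show ?thesis by (simp add: Q_def)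
  qed
  have "Q * Q * (Q * Q) = herm_diag Y ?N (\<lambda>i. g i powr (1/4) * g i powr (1/4) * (g i powr (1/4) * g i powr (1/4)))"
    using Y by (simp add: Q_def herm_diag_mult)
  also have "\<dots> = kron (1\<^sub>m m) \<sigma>"
    unfolding G using g by (intro herm_diag_cong) (simp flip: powr_add)
  finally have "tr (Q * Q * (Q * Q)) = tr (1\<^sub>m m) * tr \<sigma>"
    using \<sigma>' by (simp add: tr_kron)
  then have trQ: "tr (Q * Q * (Q * Q)) = of_nat m" using \<sigma>' by (simp add: tr_def)
  \<comment> \<open>On zero eigenvalues both factors vanish, so the product is the support
    projection instead of the identity.\<close>
  have QS: "Q * S = Pr" "S * Q = Pr"
    unfolding Q_def S Pr_def herm_diag_mult[OF Y] using g
    by (intro herm_diag_cong; force simp flip: powr_add)+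
  have \<phi>_Pr: "\<phi> * Pr = \<phi>"
    unfolding Pr_def using ker \<phi> by (intro mult_support_projection[OF Y]) (auto simp: G)
  have Pr_carr: "Pr \<in> carrier_mat ?N ?N" "adj Pr = Pr" using Y by (auto simp: Pr_def)
  have "adj (\<phi> * Pr) = \<phi>" using \<phi> by (simp only: \<phi>_Pr)
  then have Pr_\<phi>: "Pr * \<phi> = \<phi>" using \<phi> Pr_carr by (simp add: adj_mult)
  have "Q * (S * \<phi> * S) * Q = (Q * S) * \<phi> * (S * Q)"
    using carrier_matD[OF carr(1)] carrier_matD[OF carr(3)] carrier_matD[OF \<phi>(1)] by (simp add: mult_mat_assoc)
  then have "\<phi> = Q * (S * \<phi> * S) * Q" by (simp add: QS \<phi>_Pr Pr_\<phi>)
  then show ?thesis using that carr comm trQ by blast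
qed

text \<open>The estimate for one fixed \<sigma>. The first bound is Cauchy-Schwarz for 1 = Tr Q^2 X;
  it keeps \<open>c\<close> positive and later bounds the infimum from below. The second combines
  the weighted trace norm bound with the second moment.\<close>

lemma weighted_collision_bounds:
  fixes n l d :: nat
  assumes n: "n \<ge> 1" and l: "l \<le> 2 * n"
    and P: "irreducible P" "degree P = max l (2 * n - l)"
    and \<phi>: "density (2 ^ n * d) \<phi>" and \<sigma>: "density d \<sigma>"
    and ker: "\<And>v. dim_vec v = 2 ^ n * d \<Longrightarrow> kron (1\<^sub>m (2 ^ n)) \<sigma> *\<^sub>v v = 0\<^sub>v (2 ^ n * d) \<Longrightarrow> \<phi> *\<^sub>v v = 0\<^sub>v (2 ^ n * d)"
  defines "S \<equiv> mpow_m14 (kron (1\<^sub>m (2 ^ n)) \<sigma>)"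
  defines "c \<equiv> Re (tr ((S * \<phi> * S) * (S * \<phi> * S)))"
  shows "1 \<le> 2 ^ n * c"
    and "((\<Sum>u<2 ^ degree P. \<Sum>v<2 ^ (2 * n - l).
        trace_norm (R_op P n l d u v \<phi> - kron (maxmixed (2 ^ n)) (ptrace_A (2 ^ n) d \<phi>)))
          / (2 ^ degree P * 2 ^ (2 * n - l)))\<^sup>2 \<le> 2 ^ n / 2 ^ l * c"
proof -
  let ?N = "2 ^ n * d" and ?r = "degree P" and ?m = "2 * n - l"
  have \<phi>': "\<phi> \<in> carrier_mat ?N ?N" "adj \<phi> = \<phi>" "psd \<phi>" "tr \<phi> = 1"
    using \<phi> by (auto simp: density_def psd_def hermitian_def)
  obtain Q where S: "S \<in> carrier_mat ?N ?N" "adj S = S" and Q: "Q \<in> carrier_mat ?N ?N" "adj Q = Q"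
    and comm: "\<And>W. W \<in> carrier_mat (2 ^ n) (2 ^ n) \<Longrightarrow> kron W (1\<^sub>m d) * Q = Q * kron W (1\<^sub>m d)"
    and trQ: "tr (Q * Q * (Q * Q)) = of_nat (2 ^ n)" and \<phi>_eq: "\<phi> = Q * (S * \<phi> * S) * Q"
    using fourth_roots[OF \<sigma> \<phi>'(1,2) ker] unfolding S_def by blast
  define X where "X = S * \<phi> * S"
  note [simp] = carrier_matD[OF S(1)] carrier_matD[OF Q(1)] carrier_matD[OF \<phi>'(1)]
  have X: "X \<in> carrier_mat ?N ?N" "adj X = X"
    using S \<phi>' by (auto simp: X_def adj_mult mult_mat_assoc)
  note [simp] = carrier_matD[OF X(1)]
  have c: "c = Re (tr (adj X * X))" by (simp add: c_def X_def[symmetric] X(2))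
  obtain K where K: "K \<in> carrier_mat ?N ?N" "\<phi> = K * adj K"
    using psd_factorisation \<phi>' by blast
  define L where "L = S * K"
  have L: "L \<in> carrier_mat ?N ?N" "X = L * adj L"
    using carrier_matD[OF K(1)] by (auto simp: L_def X_def K(2) adj_mult S mult_mat_assoc)
  show "1 \<le> 2 ^ n * c"
  proof -
    have "tr \<phi> = tr (Q * (X * Q))"
      using \<phi>_eq by (simp add: X_def mult_mat_assoc)
    also have "\<dots> = tr (X * (Q * Q))"
      by (subst tr_mult_commute) (simp_all add: mult_mat_assoc)
    also have "\<dots> = tr (adj (Q * Q) * X)"
      by (subst tr_mult_commute) (simp_all add: adj_mult Q)
    finally have "1 = (cmod (tr (adj (Q * Q) * X)))\<^sup>2" using \<phi>' by simp
    also have "\<dots> \<le> Re (tr (adj (Q * Q) * (Q * Q))) * Re (tr (adj X * X))"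
      by (rule tr_Cauchy_Schwarz) auto
    finally show ?thesis by (simp add: adj_mult Q trQ c)
  qed
  let ?a = "\<lambda>u v. trace_norm (R_op P n l d u v \<phi> - kron (maxmixed (2 ^ n)) (ptrace_A (2 ^ n) d \<phi>))"
  have a: "(?a u v)\<^sup>2 \<le> 2 ^ n * Re (tr (deviation P n l d u v X * deviation P n l d u v X))" for u v
  proof -
    have "deviation P n l d u v \<phi> = deviation P n l d u v (Q * X * Q)"
      unfolding X_def using \<phi>_eq by simp
    also have "\<dots> = Q * deviation P n l d u v X * Q"
      by (intro deviation_conj X Q comm carrier_matI) auto
    finally have "deviation P n l d u v \<phi> = Q * deviation P n l d u v X * Q" .
    from trace_norm_weighted_le[OF deviation_carrier adj_deviation[OF \<phi>'(1,2)] Q deviation_carrier this]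
    have "(trace_norm (deviation P n l d u v \<phi>))\<^sup>2 \<le> Re (tr (Q * Q * (Q * Q))) *
        Re (tr (adj (deviation P n l d u v X) * deviation P n l d u v X))" .
    then show ?thesis
      unfolding R_op_minus_eq_deviation[OF \<phi>'(1)] adj_deviation[OF X] trQ by simp
  qed
  \<comment> \<open>The maximum of \<open>l\<close> and \<open>2 * n - l\<close> is at least
    \<open>n\<close>, hence positive.\<close>
  have r: "?r > 0" using P n l by auto
  have "(\<Sum>u<2 ^ ?r. \<Sum>v<2 ^ ?m. (?a u v)\<^sup>2) = (\<Sum>v<2 ^ ?m. \<Sum>u<2 ^ ?r. (?a u v)\<^sup>2)"
    by (rule sum.swap)
  also have "\<dots> \<le> (\<Sum>v<(2::nat) ^ ?m. 2 ^ n * (2 ^ ?r / 2 ^ l * c))"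
  proof (rule sum_mono)
    fix v :: nat assume v: "v \<in> {..<2 ^ ?m}"
    have "(\<Sum>u<2 ^ ?r. (?a u v)\<^sup>2) \<le>
        2 ^ n * (\<Sum>u<2 ^ ?r. Re (tr (deviation P n l d u v X * deviation P n l d u v X)))"
      unfolding sum_distrib_left by (intro sum_mono a)
    also have "\<dots> \<le> 2 ^ n * (2 ^ ?r / 2 ^ l * Re (tr (X * X)))"
      using v by (intro mult_left_mono sum_tr_deviation_square_le[OF X(1) L P r l]) auto
    finally show "(\<Sum>u<2 ^ ?r. (?a u v)\<^sup>2) \<le> 2 ^ n * (2 ^ ?r / 2 ^ l * c)"
      by (simp add: c X(2))
  qed
  finally have sq: "(\<Sum>u<2 ^ ?r. \<Sum>v<2 ^ ?m. (?a u v)\<^sup>2) \<le> 2 ^ ?m * (2 ^ n * (2 ^ ?r / 2 ^ l * c))"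
    by simp
  let ?I = "{..<(2::nat) ^ ?r} \<times> {..<(2::nat) ^ ?m}"
  have "(\<Sum>u<2 ^ ?r. \<Sum>v<2 ^ ?m. ?a u v)\<^sup>2 = (\<Sum>p\<in>?I. ?a (fst p) (snd p))\<^sup>2"
    by (simp add: sum.cartesian_product case_prod_beta)
  \<comment> \<open>Jensen's inequality for the square, over the uniform pair (u, v).\<close>
  also have "\<dots> \<le> (\<Sum>p\<in>?I. (?a (fst p) (snd p))\<^sup>2) * real (card ?I)"
    by (rule sum_squared_le_sum_of_squares)
  also have "(\<Sum>p\<in>?I. (?a (fst p) (snd p))\<^sup>2) = (\<Sum>u<2 ^ ?r. \<Sum>v<2 ^ ?m. (?a u v)\<^sup>2)"
    by (simp add: sum.cartesian_product case_prod_beta)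
  also have "\<dots> * real (card ?I) \<le> 2 ^ ?m * (2 ^ n * (2 ^ ?r / 2 ^ l * c)) * real (card ?I)"
    by (intro mult_right_mono sq) simp
  finally have "(\<Sum>u<2 ^ ?r. \<Sum>v<2 ^ ?m. ?a u v)\<^sup>2 \<le> (2 ^ ?r * 2 ^ ?m)\<^sup>2 * (2 ^ n / 2 ^ l * c)"
    by (simp add: power2_eq_square mult_ac)
  then show "((\<Sum>u<2 ^ ?r. \<Sum>v<2 ^ ?m. ?a u v) / (2 ^ ?r * 2 ^ ?m))\<^sup>2 \<le> 2 ^ n / 2 ^ l * c"
    by (simp add: power_divide pos_divide_le_eq mult.commute)
qed

section \<open>The maximally mixed state as a witness for a finite infimum\<close>

lemma index_diag_mat_mult_vec:
  assumes "i < k" "dim_vec v = k"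
  shows "(diag_mat k f *\<^sub>v v) $ i = f i * v $ i"
proof -
  have "(diag_mat k f *\<^sub>v v) $ i = (\<Sum>j<k. if j = i then f i * v $ i else 0)"
    using assms unfolding lessThan_atLeast0
    by (auto simp: scalar_prod_def diag_mat_def intro!: sum.cong simp del: sum.delta sum.delta')
  then show ?thesis using assms by simp
qed

lemma maxmixed_eq_diag_mat: "maxmixed d = diag_mat d (\<lambda>_. 1 / of_nat d)"
  by (simp add: maxmixed_def diag_mat_def)

lemma density_maxmixed:
  assumes "d > 0"
  shows "density d (maxmixed d)"
proof -
  have "0 \<le> Re (conjugate v \<bullet> (maxmixed d *\<^sub>v v))" if v: "dim_vec v = d" for v
  proof -
    have "conjugate v \<bullet> (maxmixed d *\<^sub>v v) = (\<Sum>i<d. cnj (v $ i) * (1 / of_nat d * v $ i))"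
      unfolding maxmixed_eq_diag_mat lessThan_atLeast0 using v
      by (auto simp: scalar_prod_def index_diag_mat_mult_vec simp del: index_mult_mat_vec intro!: sum.cong)
    also have "\<dots> = (\<Sum>i<d. complex_of_real ((cmod (v $ i))\<^sup>2 / real d))"
      by (intro sum.cong) (auto simp: complex_norm_square mult.commute simp del: of_real_power)
    also have "Re \<dots> = (\<Sum>i<d. (cmod (v $ i))\<^sup>2 / real d)"
      unfolding Re_sum Re_complex_of_real ..
    also have "\<dots> \<ge> 0" by (intro sum_nonneg) auto
    finally show ?thesis .
  qed
  moreover have "tr (maxmixed d) = 1"
    using assms by (simp add: maxmixed_eq_diag_mat tr_diag_mat)
  moreover have "hermitian (maxmixed d)"
    by (simp add: hermitian_def maxmixed_eq_diag_mat adj_diag_mat)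
  ultimately show ?thesis
    by (simp add: density_def psd_def) (simp add: maxmixed_eq_diag_mat)
qed

text \<open>The operator is a positive multiple of the identity, so the kernel condition in
  \<open>D2\<close> holds for every state.\<close>

lemma kron_one_maxmixed_kernel:
  assumes "dim_vec v = m * d" "kron (1\<^sub>m m) (maxmixed d) *\<^sub>v v = 0\<^sub>v (m * d)"
  shows "v = 0\<^sub>v (m * d)"
proof (rule eq_vecI)
  fix i assume "i < dim_vec (0\<^sub>v (m * d) :: complex vec)"
  then have i: "i < m * d" by simp
  then have d: "d > 0" by (cases d) auto
  have "(diag_mat (m * d) (\<lambda>_. 1 / of_nat d) *\<^sub>v v) $ i = 0"
    using assms i by (simp add: maxmixed_eq_diag_mat kron_one_diag_mat del: index_mult_mat_vec)
  then show "v $ i = 0\<^sub>v (m * d) $ i"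
    using i d assms by (simp add: index_diag_mat_mult_vec del: index_mult_mat_vec)
qed (use assms in simp)

theorem theorem3:
  fixes n l dE :: nat and P :: "bit poly" and \<phi> :: "complex mat"
  assumes "n \<ge> 1" and "l \<le> 2*n"
    and "irreducible P" and "degree P = max l (2*n - l)"
    and "density (2^n * dE) \<phi>"
  shows "(\<Sum>u<2^(max l (2*n - l)). \<Sum>v<2^(2*n - l).
            trace_norm (R_op P n l dE u v \<phi> - kron (maxmixed (2^n)) (ptrace_A (2^n) dE \<phi>)))
          / (2^(max l (2*n - l)) * 2^(2*n - l))
       \<le> sqrt (2 powr (real n - real l - real_of_ereal (H2 (2^n) dE \<phi>)))"
    (is "?avg \<le> _")
proof -
  let ?N = "2 ^ n * dE" and ?G = "\<lambda>\<sigma>. kron (1\<^sub>m (2 ^ n)) \<sigma>"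
  let ?ker = "\<lambda>\<sigma>. \<forall>v. dim_vec v = ?N \<longrightarrow> ?G \<sigma> *\<^sub>v v = 0\<^sub>v ?N \<longrightarrow> \<phi> *\<^sub>v v = 0\<^sub>v ?N"
  let ?X = "\<lambda>\<sigma>. mpow_m14 (?G \<sigma>) * \<phi> * mpow_m14 (?G \<sigma>)"
  let ?c = "\<lambda>\<sigma>. Re (tr (?X \<sigma> * ?X \<sigma>))"
  define Ds where "Ds = {D2 \<phi> (?G \<sigma>) | \<sigma>. density dE \<sigma>}"
  have \<phi>: "\<phi> \<in> carrier_mat ?N ?N" "tr \<phi> = 1" using assms by (auto simp: density_def)
  \<comment> \<open>With \<open>dE = 0\<close> the matrix would be empty and its trace 0 instead of
    1.\<close>
  then have dE: "dE > 0" by (cases dE) (auto simp: tr_def)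
  have D2: "D2 \<phi> (?G \<sigma>) = (if ?ker \<sigma> then ereal (log 2 (?c \<sigma>)) else \<infinity>)" if "density dE \<sigma>" for \<sigma>
  proof -
    have "dim_row \<sigma> = dE" "dim_col \<sigma> = dE" using that by (auto simp: density_def)
    then show ?thesis using \<phi> unfolding D2_def by simp
  qed
  have bounds: "1 \<le> 2 ^ n * ?c \<sigma>" "?avg\<^sup>2 \<le> 2 ^ n / 2 ^ l * ?c \<sigma>" if "density dE \<sigma>" "?ker \<sigma>" for \<sigma>
    using weighted_collision_bounds[OF assms(1-5) that(1)] that(2) unfolding assms(4) by blast+
  have c_pos: "?c \<sigma> > 0" if "density dE \<sigma>" "?ker \<sigma>" for \<sigma>
  proof -
    have "0 < 2 ^ n * ?c \<sigma>" using bounds(1)[OF that] by linarith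
    then show ?thesis by (simp add: zero_less_mult_iff)
  qed
  \<comment> \<open>Finiteness matters because \<open>real_of_ereal\<close> sends infinite values to
    0. This bound excludes minus infinity; the maximally mixed state below excludes plus
    infinity.\<close>
  have lower: "ereal (- real n) \<le> Inf Ds"
  proof (rule Inf_greatest)
    fix D assume "D \<in> Ds"
    then obtain \<sigma> where \<sigma>: "density dE \<sigma>" "D = D2 \<phi> (?G \<sigma>)" by (auto simp: Ds_def)
    have "- real n \<le> log 2 (?c \<sigma>)" if "?ker \<sigma>"
    proof -
      have "2 powr (- real n) \<le> ?c \<sigma>"
        using bounds(1)[OF \<sigma>(1) that] by (simp add: powr_minus powr_realpow field_simps)
      then show ?thesis using c_pos[OF \<sigma>(1) that] by (simp add: le_log_iff)
    qed
    then show "ereal (- real n) \<le> D" using \<sigma> by (simp add: D2)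
  qed
  have "?ker (maxmixed dE)"
  proof (intro allI impI)
    fix v :: "complex vec" assume "dim_vec v = ?N" "?G (maxmixed dE) *\<^sub>v v = 0\<^sub>v ?N"
    then have "v = 0\<^sub>v ?N" by (rule kron_one_maxmixed_kernel)
    then show "\<phi> *\<^sub>v v = 0\<^sub>v ?N" using \<phi> by auto
  qed
  then have "D2 \<phi> (?G (maxmixed dE)) = ereal (log 2 (?c (maxmixed dE)))"
    using density_maxmixed[OF dE] by (simp add: D2)
  moreover have "Inf Ds \<le> D2 \<phi> (?G (maxmixed dE))"
    using density_maxmixed[OF dE] by (intro Inf_lower) (auto simp: Ds_def)
  ultimately have "Inf Ds \<noteq> \<infinity>" by auto
  moreover have "Inf Ds \<noteq> -\<infinity>" using lower by auto
  ultimately obtain r where r: "Inf Ds = ereal r" by (cases "Inf Ds") auto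
  have H2: "real_of_ereal (H2 (2 ^ n) dE \<phi>) = - r"
    unfolding H2_def Ds_def[symmetric] r by simp
  show ?thesis
  proof (cases "?avg > 0")
    \<comment> \<open>Logarithms need a positive average; otherwise the nonnegative right side
      settles the claim.\<close>
    case False
    then show ?thesis by (meson order_trans linorder_not_less real_sqrt_ge_zero powr_ge_zero)
  next
    case True
    \<comment> \<open>In logarithmic form the estimate for each \<sigma> is a lower bound on
      \<open>D2\<close>, so it passes to the infimum whether or not that is attained.\<close>
    have "ereal (log 2 (?avg\<^sup>2) - real n + real l) \<le> Inf Ds"
    proof (rule Inf_greatest)
      fix D assume "D \<in> Ds"
      then obtain \<sigma> where \<sigma>: "density dE \<sigma>" "D = D2 \<phi> (?G \<sigma>)" by (auto simp: Ds_def)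
      have "log 2 (?avg\<^sup>2) - real n + real l \<le> log 2 (?c \<sigma>)" if k: "?ker \<sigma>"
      proof -
        have "log 2 (?avg\<^sup>2) \<le> log 2 (2 ^ n / 2 ^ l * ?c \<sigma>)"
          using bounds(2)[OF \<sigma>(1) k] True by (intro log_mono) auto
        also have "\<dots> = real n - real l + log 2 (?c \<sigma>)"
          using c_pos[OF \<sigma>(1) k] by (simp add: log_mult log_divide log_nat_power)
        finally show ?thesis by linarith
      qed
      then show "ereal (log 2 (?avg\<^sup>2) - real n + real l) \<le> D" using \<sigma> by (simp add: D2)
    qed
    then have "log 2 (?avg\<^sup>2) \<le> real n - real l + r" by (simp add: r)
    then have "?avg\<^sup>2 \<le> 2 powr (real n - real l + r)"
      using True by (subst (asm) log_le_iff) auto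
    then show ?thesis unfolding H2 by (intro real_le_rsqrt) simp
  qed
qed

end
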